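(* Let $d\ge1$, let $a:\mathbb R^d\to[0,\infty)$ be a bounded, continuous, even, integrable function with $\int_{\mathbb R^d}a(x)\,dx=1$, and let $V$ be a continuous compactly supported function on $\mathbb R^d$ with $0\le V\le1$ and $V\not\equiv0$. Let $L$ be the operator on $L^2(\mathbb R^d)$ given by $$Lu(x)=\int_{\mathbb R^d}a(x-y)(u(y)-u(x))\,dy+V(x)u(x),$$ and suppose that $L$ has a ground state, i.e. a positive principal eigenfunction $\psi_\lambda\in L^2(\mathbb R^d)$ with $L\psi_\lambda=\lambda\psi_\lambda$, where $\lambda>0$ is the principal eigenvalue. Then the following hold. (i) If there are $\alpha>0$ and $0<c_-\le c_+$ with $c_-(1+|x|)^{-(d+\alpha)}\le a(x)\le c_+(1+|x|)^{-(d+\alpha)}$ for all $x\in\mathbb R^d$, then there are constants $0<\tilde c_-(\lambda)\le\tilde c_+(\lambda)$ with $$\tilde c_-(\lambda)(1+|x|)^{-(d+\alpha)}\le\psi_\lambda(x)\le\tilde c_+(\lambda)(1+|x|)^{-(d+\alpha)}.$$ (ii) If there are $c>0$ and $\delta>0$ with $a(x)\le c\,e^{-\delta|x|}$ for all $x\in\mathbb R^d$, then there are positive constants $K(\lambda)$, $m(\lambda)$ with $$\psi_\lambda(x)\le K(\lambda)e^{-m(\lambda)|x|}.$$ (iii) Let $d=1$, suppose that $\lim_{|x|\to\infty}\frac{\ln a(x)}{|x|}=-c$ for some constant $c>0$, and that for every $0\le\kappa<c$ the function $v\mapsto\int_{\mathbb R}a(x)e^{\kappa x}e^{-ivx}\,dx$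 belongs to $L^1(\mathbb R)$. Then: - if there exists $q=q(\lambda)\in(0,c)$ with $\int_{\mathbb R}a(x)e^{qx}\,dx=1+\lambda$ (equivalently, $iq(\lambda)$ is a solution of $\tilde a(p)=1+\lambda$, where $\tilde a(p)=\int_{\mathbb R}e^{-ipx}a(x)\,dx$), then there is a constant $C(\lambda)$ such that $$\psi_\lambda(x)=e^{-q(\lambda)|x|}\,(C(\lambda)+o(1))\quad\text{as }|x|\to\infty;$$ - if no such $q<c$ exists, then for any $\varepsilon>0$ there are positive constants $C_-(\lambda)$, $C_+(\lambda)$ such that $$C_-(\lambda)e^{-(c+\varepsilon)|x|}\le\psi_\lambda(x)\le C_+(\lambda)e^{-(c-\varepsilon)|x|}.$$
   Context: The principal eigenvalue $\lambda$ of $L$ is its largest positive eigenvalue; the principal eigenfunction (ground state) $\psi_\lambda$ is the corresponding eigenfunction, which is positive.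
   Formalization: In (iii), first bullet, the single constant C(λ) as |x|→∞ is replaced by two constants, one for x→+∞ and one for x→−∞; with a single constant the claim fails, e.g. for a(x)=e^{-|x|}/2 and V a translate of an even potential. *)

theory Defs
  imports "HOL-Analysis.Analysis"
begin

definition dispersal_kernel :: "('a::euclidean_space \<Rightarrow> real) \<Rightarrow> bool" where
  "dispersal_kernel a \<longleftrightarrow>
     (\<forall>x. 0 \<le> a x) \<and> bounded (range a) \<and> continuous_on UNIV a \<and>
     (\<forall>x. a (- x) = a x) \<and> integrable lborel a \<and> (LINT x|lborel. a x) = 1"

definition admissible_potential :: "('a::euclidean_space \<Rightarrow> real) \<Rightarrow> bool" where
  "admissible_potential V \<longleftrightarrow>
     continuous_on UNIV V \<and> compact (closure {x. V x \<noteq> 0}) \<and>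
     (\<forall>x. 0 \<le> V x \<and> V x \<le> 1) \<and> (\<exists>x. V x \<noteq> 0)"

text \<open>Elements of $L^2$ are represented by Borel functions; all identities between them are
  almost-everywhere identities.\<close>

definition L2_fun :: "('a::euclidean_space \<Rightarrow> real) \<Rightarrow> bool" where
  "L2_fun u \<longleftrightarrow> u \<in> borel_measurable lborel \<and> integrable lborel (\<lambda>x. (u x)\<^sup>2)"

text \<open>For a dispersal kernel \<open>a\<close> (which lies in both $L^1$ and $L^2$) and a square-integrable
  \<open>u\<close>, the integrand below is integrable for every \<open>x\<close>, so the Bochner integral never takes its
  default value.\<close>

definition nonlocal_op ::
  "('a::euclidean_space \<Rightarrow> real) \<Rightarrow> ('a \<Rightarrow> real) \<Rightarrow> ('a \<Rightarrow> real) \<Rightarrow> 'a \<Rightarrow> real" where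
  "nonlocal_op a V u x = (LINT y|lborel. a (x - y) * (u y - u x)) + V x * u x"

definition L2_eigenfunction ::
  "('a::euclidean_space \<Rightarrow> real) \<Rightarrow> ('a \<Rightarrow> real) \<Rightarrow> real \<Rightarrow> ('a \<Rightarrow> real) \<Rightarrow> bool" where
  "L2_eigenfunction a V \<mu> u \<longleftrightarrow>
     L2_fun u \<and> \<not> (AE x in lborel. u x = 0) \<and>
     (AE x in lborel. nonlocal_op a V u x = \<mu> * u x)"

text \<open>The operator is self-adjoint on $L^2$ with real coefficients, so real eigenvalues and
  real-valued eigenfunctions suffice.\<close>

definition principal_eigenvalue ::
  "('a::euclidean_space \<Rightarrow> real) \<Rightarrow> ('a \<Rightarrow> real) \<Rightarrow> real \<Rightarrow> bool" where
  "principal_eigenvalue a V lam \<longleftrightarrow>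
     0 < lam \<and> (\<exists>u. L2_eigenfunction a V lam u) \<and>
     (\<forall>\<mu> u. L2_eigenfunction a V \<mu> u \<longrightarrow> \<mu> \<le> lam)"

definition ground_state ::
  "('a::euclidean_space \<Rightarrow> real) \<Rightarrow> ('a \<Rightarrow> real) \<Rightarrow> real \<Rightarrow> ('a \<Rightarrow> real) \<Rightarrow> bool" where
  "ground_state a V lam \<psi> \<longleftrightarrow>
     principal_eigenvalue a V lam \<and> L2_eigenfunction a V lam \<psi> \<and> (AE x in lborel. 0 < \<psi> x)"

text \<open>Pointwise statements about an $L^2$ class refer to its continuous representative, which is
  unique when it exists. Ground states have one: the eigenvalue equation reads
  $(1 + \lambda - V)\psi = a * \psi$, where $1 + \lambda - V \geq \lambda > 0$ and the right-hand
  side is continuous.\<close>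

definition continuous_representative ::
  "('a::euclidean_space \<Rightarrow> real) \<Rightarrow> ('a \<Rightarrow> real) \<Rightarrow> bool" where
  "continuous_representative \<phi> \<psi> \<longleftrightarrow>
     continuous_on UNIV \<phi> \<and> (AE x in lborel. \<phi> x = \<psi> x)"

text \<open>The value at $v + i\kappa$ of $\tilde a(p) = \int e^{-ipx} a(x)\,dx$.\<close>

definition tilted_fourier :: "(real \<Rightarrow> real) \<Rightarrow> real \<Rightarrow> real \<Rightarrow> complex" where
  "tilted_fourier a \<kappa> v =
     (LINT x|lborel. complex_of_real (a x * exp (\<kappa> * x)) * exp (- (\<i> * complex_of_real (v * x))))"

text \<open>The limit of \<open>ln (a x) / \<bar>x\<bar>\<close> at infinity. The convention \<open>ln 0 = 0\<close> is harmless: a nonzero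
  limit forces \<open>a x \<noteq> 0\<close> for all large \<open>\<bar>x\<bar>\<close>.\<close>

definition log_decay_rate :: "(real \<Rightarrow> real) \<Rightarrow> real \<Rightarrow> bool" where
  "log_decay_rate a c \<longleftrightarrow> ((\<lambda>x. ln (a x) / \<bar>x\<bar>) \<longlongrightarrow> - c) at_infinity"

end

theory Submission
  imports Defs
begin

text \<open>With \<open>1 + \<lambda> - V \<ge> \<lambda>\<close> the eigenvalue equation gives the continuous positive bounded
  representative \<open>\<phi> = (a * \<psi>) / (1 + \<lambda> - V)\<close>. Outside the support of \<open>V\<close> it solves
  \<open>(1 + \<lambda>) \<phi> = a * \<phi>\<close>, and a maximum principle (using only \<open>\<integral> a = 1\<close> and \<open>\<lambda> > 0\<close>)
  bounds it by any positive \<open>w\<close> with \<open>a * w \<le> (1 + \<lambda>) w\<close> near infinity: the choices are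
  \<open>(M + |x|)\<^sup>-\<^sup>\<beta>\<close> with \<open>M\<close> large and \<open>exp (- m |x|)\<close>. Lower bounds follow
  by restricting the convolution in \<open>(1 + \<lambda>) \<phi> \<ge> a * \<phi>\<close> to the unit ball.

  For the exact asymptotics, \<open>u(x) = \<phi>(x) exp (q x)\<close> solves a renewal equation \<open>u = p * u + g\<close> with the
  probability density \<open>p(x) = a(x) exp (q x) / (1 + \<lambda>)\<close> of positive mean \<open>\<mu>\<close>. If \<open>u(x\<^sub>n)\<close> tends to the upper
  limit \<open>S\<close> of \<open>u\<close> at infinity, then so do almost all translates \<open>u(x\<^sub>n - y)\<close> along a subsequence.
  Integrating the equation over \<open>(-\<infinity>, x\<^sub>n]\<close> then forces \<open>S \<mu> = \<integral> g\<close>. The same argument for \<open>- u\<close> gives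
  the same value for the lower limit.\<close>

section \<open>Convolutions and the comparison principle\<close>

lemma distr_reflect: "distr lborel borel (\<lambda>y. x - y) = (lborel :: 'a::euclidean_space measure)"
  using lborel_affine[of "-1" x] by (simp add: density_1)

lemma integrable_reflect:
  fixes f :: "'a::euclidean_space \<Rightarrow> real"
  assumes "integrable lborel f"
  shows "integrable lborel (\<lambda>y. f (x - y))"
proof -
  have "integrable (distr lborel borel (\<lambda>y. x - y)) f"
    using assms by (simp add: distr_reflect)
  then show ?thesis
    by (rule integrable_distr[rotated]) simp
qed

lemma integral_reflect:
  fixes f :: "'a::euclidean_space \<Rightarrow> real"
  assumes "f \<in> borel_measurable borel"
  shows "(LINT y|lborel. f (x - y)) = (LINT y|lborel. f y)"
  using integral_distr[of "\<lambda>y. x - y" lborel borel f] assms by (simp add: distr_reflect)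

lemma integral_convolution_commute:
  fixes f g :: "'a::euclidean_space \<Rightarrow> real"
  assumes [measurable]: "f \<in> borel_measurable borel" "g \<in> borel_measurable borel"
  shows "(LINT y|lborel. f (x - y) * g y) = (LINT y|lborel. f y * g (x - y))"
  using integral_reflect[of "\<lambda>y. f y * g (x - y)" x] by simp

lemma AE_reflect:
  fixes P :: "'a::euclidean_space \<Rightarrow> bool"
  assumes "AE y in lborel. P y"
  shows "AE y in lborel. P (x - y)"
proof -
  have "AE y in distr lborel borel (\<lambda>y. x - y). P y"
    unfolding distr_reflect by (rule assms)
  then show ?thesis
    by (rule AE_distrD[rotated]) simp
qed

text \<open>The integrand is dominated by a step function: the single summand with
  \<open>n = \<lfloor>norm x\<rfloor>\<close> already exceeds it. The balls involved have
  polynomially growing volume against the exponentially small weights \<open>e n\<close>.\<close>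

lemma integrable_exp_norm:
  assumes s: "0 < s"
  shows "integrable lborel (\<lambda>x::'a::euclidean_space. exp (- s * norm x))"
proof -
  let ?d = "DIM('a)"
  define e where "e n = exp (- s * real n)" for n :: nat
  define m where "m n = measure lborel (ball (0::'a) (real (Suc n)))" for n
  have m: "m n = unit_ball_vol (real ?d) * real (Suc n) ^ ?d" for n
    unfolding m_def by (subst content_ball) auto
  have le: "exp (- s * norm x) \<le> (\<Sum>n. ennreal (e n) * indicator (ball (0::'a) (real (Suc n))) x)" for x :: 'a
  proof -
    define n where "n = nat \<lfloor>norm x\<rfloor>"
    have n: "real n \<le> norm x" "norm x < real (Suc n)"
      unfolding n_def using norm_ge_zero[of x] by linarith+
    have "ennreal (exp (- s * norm x)) \<le> ennreal (e n) * indicator (ball (0::'a) (real (Suc n))) x"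
      using n s by (auto simp: e_def indicator_def)
    also have "\<dots> \<le> (\<Sum>n. ennreal (e n) * indicator (ball (0::'a) (real (Suc n))) x)"
      by (intro sum_le_suminf[of _ "{n}", simplified]) auto
    finally show ?thesis .
  qed
  have sm: "summable (\<lambda>n. e n * m n)"
  proof -
    \<comment> \<open>Used at \<open>t = s * (n + 1) / 2\<close>, so that the volume factor consumes
      only half of the decay rate and a geometric series of ratio \<open>exp (- s / 2)\<close>
      remains.\<close>
    have "((\<lambda>t. t ^ ?d / exp t) \<longlongrightarrow> (0::real)) at_top"
      by (rule tendsto_power_div_exp_0)
    then have "eventually (\<lambda>t::real. t ^ ?d / exp t < 1) at_top"
      by (rule order_tendstoD) simp
    then obtain T :: real where T: "\<And>t. t \<ge> T \<Longrightarrow> t ^ ?d < exp t"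
      by (auto simp: eventually_at_top_linorder field_simps)
    obtain N :: nat where N: "T * 2 / s \<le> real N"
      using real_arch_simple by blast
    have bd: "real (Suc n) ^ ?d \<le> (2 / s) ^ ?d * exp (s / 2) * exp (s * real n / 2)" if "N \<le> n" for n
    proof -
      have "T \<le> s * real (Suc n) / 2"
      proof -
        have "T * 2 / s \<le> real (Suc n)" using N that by simp
        then show ?thesis using s by (simp add: field_simps)
      qed
      from T[OF this] have "(s * real (Suc n) / 2) ^ ?d \<le> exp (s * real (Suc n) / 2)" by simp
      then have "(2 / s) ^ ?d * (s * real (Suc n) / 2) ^ ?d \<le> (2 / s) ^ ?d * exp (s * real (Suc n) / 2)"
        using s by (intro mult_left_mono) auto
      moreover have "(2 / s) ^ ?d * (s * real (Suc n) / 2) ^ ?d = real (Suc n) ^ ?d"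
      proof -
        have "2 / s * (s * real (Suc n) / 2) = real (Suc n)"
          using s by (simp del: of_nat_Suc)
        then show ?thesis by (metis power_mult_distrib)
      qed
      moreover have "exp (s * real (Suc n) / 2) = exp (s / 2) * exp (s * real n / 2)"
        by (simp add: exp_add[symmetric] field_simps)
      ultimately show ?thesis by (simp add: mult.assoc)
    qed
    let ?C = "unit_ball_vol (real ?d) * ((2 / s) ^ ?d * exp (s / 2))"
    show ?thesis
    proof (rule summable_comparison_test)
      show "\<exists>N. \<forall>n\<ge>N. norm (e n * m n) \<le> ?C * (exp (- s / 2) ^ n)"
      proof (intro exI allI impI)
        fix n assume "N \<le> n"
        have "norm (e n * m n) = e n * (unit_ball_vol (real ?d) * real (Suc n) ^ ?d)"
          by (simp add: m e_def abs_mult)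
        also have "\<dots> \<le> e n * (unit_ball_vol (real ?d) * ((2 / s) ^ ?d * exp (s / 2) * exp (s * real n / 2)))"
          using bd[OF \<open>N \<le> n\<close>] by (intro mult_left_mono) (auto simp: e_def)
        also have "\<dots> = ?C * (e n * exp (s * real n / 2))" by simp
        also have "e n * exp (s * real n / 2) = exp (- s / 2) ^ n"
          by (simp add: e_def exp_add[symmetric] exp_of_nat_mult[symmetric] field_simps)
        finally show "norm (e n * m n) \<le> ?C * (exp (- s / 2) ^ n)" .
      qed
      show "summable (\<lambda>n. ?C * (exp (- s / 2) ^ n))"
        using s by (intro summable_mult summable_geometric) simp
    qed
  qed
  show ?thesis
  proof (rule integrableI_bounded)
    have "(\<integral>\<^sup>+(x::'a). ennreal (norm (exp (- s * norm x))) \<partial>lborel)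
        \<le> (\<integral>\<^sup>+(x::'a). (\<Sum>n. ennreal (e n) * indicator (ball (0::'a) (real (Suc n))) x) \<partial>lborel)"
      using le by (intro nn_integral_mono) simp
    also have "\<dots> = (\<Sum>n. \<integral>\<^sup>+(x::'a). ennreal (e n) * indicator (ball (0::'a) (real (Suc n))) x \<partial>lborel)"
      by (intro nn_integral_suminf borel_measurable_times_ennreal borel_measurable_indicator) auto
    also have "\<dots> = (\<Sum>n. ennreal (e n * m n))"
    proof (intro suminf_cong)
      fix n
      have "emeasure lborel (ball (0::'a) (real (Suc n))) = ennreal (m n)"
        unfolding m_def using emeasure_lborel_ball_finite[of "0::'a" "real (Suc n)"]
        by (intro emeasure_eq_ennreal_measure) auto
      then show "(\<integral>\<^sup>+(x::'a). ennreal (e n) * indicator (ball (0::'a) (real (Suc n))) x \<partial>lborel) = ennreal (e n * m n)"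
        by (simp add: nn_integral_cmult_indicator e_def ennreal_mult' m_def)
    qed
    also have "\<dots> < \<infinity>"
      using sm by (subst suminf_ennreal2) (auto simp: e_def m_def)
    finally show "(\<integral>\<^sup>+(x::'a). ennreal (norm (exp (- s * norm x))) \<partial>lborel) < \<infinity>" .
  qed measurable
qed

section \<open>Convolution of an integrable kernel with a bounded function\<close>

lemma convolution_integrable:
  fixes a w :: "'a::euclidean_space \<Rightarrow> real"
  assumes "integrable lborel a" "w \<in> borel_measurable borel" "\<And>x. \<bar>w x\<bar> \<le> B"
  shows "integrable lborel (\<lambda>y. a (x - y) * w y)"
proof (rule Bochner_Integration.integrable_bound)
  show "integrable lborel (\<lambda>y. a (x - y) * B)"
    using integrable_reflect[OF assms(1)] by simp
  show "(\<lambda>y. a (x - y) * w y) \<in> borel_measurable lborel"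
    using assms(2) borel_measurable_integrable[OF assms(1)] by simp
  show "AE y in lborel. norm (a (x - y) * w y) \<le> norm (a (x - y) * B)"
    using assms(3) abs_ge_self[of B] by (intro AE_I2) (auto simp: abs_mult intro!: mult_left_mono intro: order_trans)
qed

text \<open>Translates of \<open>a\<close> converge pointwise and share the same integral, so by
  Scheffe's lemma they converge in L1. Pairing with the bounded \<open>w\<close> then costs only the
  factor \<open>B\<close>.\<close>

lemma convolution_continuous:
  fixes a w :: "'a::euclidean_space \<Rightarrow> real"
  assumes nn: "\<And>x. 0 \<le> a x" and ac: "continuous_on UNIV a" and ai: "integrable lborel a"
    and wm [measurable]: "w \<in> borel_measurable borel" and wB: "\<And>x. \<bar>w x\<bar> \<le> B"
  shows "continuous_on UNIV (\<lambda>x. LINT y|lborel. a (x - y) * w y)"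
proof (rule continuous_on_sequentiallyI)
  fix u :: "nat \<Rightarrow> 'a" and x assume u: "u \<longlonglongrightarrow> x"
  have [measurable]: "a \<in> borel_measurable borel"
    using ac by (rule borel_measurable_continuous_onI)
  have "(\<lambda>n. \<integral>\<^sup>+y. norm (a (u n - y) - a (x - y)) \<partial>lborel) \<longlonglongrightarrow> 0"
  proof (rule Scheffe_lemma2)
    show "AE y in lborel. (\<lambda>n. a (u n - y)) \<longlonglongrightarrow> a (x - y)"
    proof (intro AE_I2)
      fix y
      have "isCont a (x - y)" using ac by (simp add: continuous_on_eq_continuous_at)
      then show "(\<lambda>n. a (u n - y)) \<longlonglongrightarrow> a (x - y)"
        by (rule isCont_tendsto_compose) (intro tendsto_intros u)
    qed
    have *: "(\<integral>\<^sup>+y. norm (a (z - y)) \<partial>lborel) = (LINT y|lborel. a y)" for z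
      using nn integrable_reflect[OF ai, of z] by (simp add: nn_integral_eq_integral integral_reflect)
    show "(\<integral>\<^sup>+y. norm (a (u n - y)) \<partial>lborel) \<le> (\<integral>\<^sup>+y. norm (a (x - y)) \<partial>lborel)" for n
      unfolding * by simp
  qed (auto intro: integrable_reflect[OF ai])
  moreover have *: "(\<integral>\<^sup>+y. norm (a (u n - y) - a (x - y)) \<partial>lborel) 
      = ennreal (LINT y|lborel. \<bar>a (u n - y) - a (x - y)\<bar>)" for n
    using integrable_reflect[OF ai] by (simp add: nn_integral_eq_integral)
  ultimately have lim: "(\<lambda>n. LINT y|lborel. \<bar>a (u n - y) - a (x - y)\<bar>) \<longlonglongrightarrow> 0"
    by (subst tendsto_ennreal_iff[symmetric]) (auto simp: *)
  have "(\<lambda>n. (LINT y|lborel. a (u n - y) * w y) - (LINT y|lborel. a (x - y) * w y)) \<longlonglongrightarrow> 0"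
  proof (rule Lim_null_comparison)
    show "(\<lambda>n. (LINT y|lborel. \<bar>a (u n - y) - a (x - y)\<bar>) * B) \<longlonglongrightarrow> 0"
      using tendsto_mult_right[OF lim, of B] by simp
    show "\<forall>\<^sub>F n in sequentially. norm ((LINT y|lborel. a (u n - y) * w y) - (LINT y|lborel. a (x - y) * w y))
        \<le> (LINT y|lborel. \<bar>a (u n - y) - a (x - y)\<bar>) * B"
    proof (intro always_eventually allI)
      fix n
      note i = convolution_integrable[OF ai wm wB]
      have "(LINT y|lborel. a (u n - y) * w y) - (LINT y|lborel. a (x - y) * w y)
          = (LINT y|lborel. (a (u n - y) - a (x - y)) * w y)"
        using i by (simp add: left_diff_distrib)
      also have "norm \<dots> \<le> (LINT y|lborel. \<bar>a (u n - y) - a (x - y)\<bar> * B)"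
      proof (intro order_trans[OF integral_norm_bound] integral_mono)
        show "integrable lborel (\<lambda>y. norm ((a (u n - y) - a (x - y)) * w y))"
          using i by (intro integrable_norm) (simp add: left_diff_distrib)
        show "integrable lborel (\<lambda>y. \<bar>a (u n - y) - a (x - y)\<bar> * B)"
          using integrable_reflect[OF ai] by simp
        show "norm ((a (u n - y) - a (x - y)) * w y) \<le> \<bar>a (u n - y) - a (x - y)\<bar> * B" for y
          using wB by (simp add: abs_mult mult_left_mono)
      qed
      finally show "norm ((LINT y|lborel. a (u n - y) * w y) - (LINT y|lborel. a (x - y) * w y))
        \<le> (LINT y|lborel. \<bar>a (u n - y) - a (x - y)\<bar>) * B" by simp
    qed
  qed
  then show "(\<lambda>n. LINT y|lborel. a (u n - y) * w y) \<longlonglongrightarrow> (LINT y|lborel. a (x - y) * w y)"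
    by (simp add: LIM_zero_iff)
qed

text \<open>Averaging against a probability density cannot lift \<open>f - w\<close> above its
  supremum \<open>M\<close>. Off \<open>A\<close> the two inequalities thus give
  \<open>f - w \<le> M / (1 + lam)\<close>, while on \<open>A\<close> the difference is at most 0. A
  positive \<open>M\<close> would then satisfy \<open>M \<le> M / (1 + lam)\<close>, whether or not
  it is attained.\<close>

lemma convolution_comparison:
  fixes a f w :: "'a::euclidean_space \<Rightarrow> real"
  assumes nn: "\<And>x. 0 \<le> a x" and ai: "integrable lborel a" and a1: "(LINT x|lborel. a x) = 1"
    and lam: "0 < lam"
    and fm: "f \<in> borel_measurable borel" and fB: "\<And>x. \<bar>f x\<bar> \<le> B"
    and wm: "w \<in> borel_measurable borel" and wB: "\<And>x. \<bar>w x\<bar> \<le> B'"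
    and sub: "\<And>x. x \<notin> A \<Longrightarrow> (1 + lam) * f x \<le> (LINT y|lborel. a (x - y) * f y)"
    and super: "\<And>x. x \<notin> A \<Longrightarrow> (LINT y|lborel. a (x - y) * w y) \<le> (1 + lam) * w x"
    and inside: "\<And>x. x \<in> A \<Longrightarrow> f x \<le> w x"
  shows "f x \<le> w x"
proof (rule ccontr)
  assume neg: "\<not> f x \<le> w x"
  define h where "h x = f x - w x" for x
  define M where "M = (SUP x. h x)"
  have bdd: "bdd_above (range h)"
  proof (rule bdd_aboveI2)
    show "h x \<le> B + B'" for x
      using fB[of x] wB[of x] by (auto simp: h_def)
  qed
  have hM: "h x \<le> M" for x
    unfolding M_def by (rule cSUP_upper[OF UNIV_I bdd])
  have M: "0 < M" using hM[of x] neg by (simp add: h_def)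
  have "h x \<le> M / (1 + lam)" for x
  proof (cases "x \<in> A")
    case True
    then have "h x \<le> 0" using inside[OF True] by (simp add: h_def)
    also have "0 \<le> M / (1 + lam)" using M lam by simp
    finally show ?thesis .
  next
    case False
    note i = convolution_integrable[OF ai fm fB, of x] convolution_integrable[OF ai wm wB, of x]
    have "(1 + lam) * h x \<le> (LINT y|lborel. a (x - y) * f y) - (LINT y|lborel. a (x - y) * w y)"
      using sub[OF False] super[OF False] by (simp add: h_def algebra_simps)
    also have "\<dots> = (LINT y|lborel. a (x - y) * h y)"
      using i by (simp add: h_def right_diff_distrib)
    also have "\<dots> \<le> (LINT y|lborel. a (x - y) * M)"
    proof (rule integral_mono)
      show "integrable lborel (\<lambda>y. a (x - y) * h y)"
        using i by (simp add: h_def right_diff_distrib)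
      show "integrable lborel (\<lambda>y. a (x - y) * M)"
        using integrable_reflect[OF ai] by simp
      show "a (x - y) * h y \<le> a (x - y) * M" for y
        by (intro mult_left_mono hM nn)
    qed
    also have "\<dots> = M"
      using integral_reflect[of a x] borel_measurable_integrable[OF ai] a1 by simp
    finally show ?thesis using lam by (simp add: field_simps)
  qed
  then have "M \<le> M / (1 + lam)"
    unfolding M_def by (intro cSUP_least) auto
  moreover have "0 < M * lam" using M lam by simp
  ultimately show False using lam by (simp add: field_simps)
qed

text \<open>For \<open>\<kappa>\<close> between 0 and \<open>M\<close> a single integrable majorant
  serves, so dominated convergence applies. Leaving \<open>h\<close> free covers both the radial
  tilt by \<open>norm\<close> and the one-sided tilt by \<open>x\<close> on the line.\<close>

lemma tilted_integral_continuous: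
  fixes a h :: "'a::euclidean_space \<Rightarrow> real"
  assumes [measurable]: "a \<in> borel_measurable borel" "h \<in> borel_measurable borel"
    and h: "\<And>x. h x \<le> norm x"
    and i: "integrable lborel (\<lambda>x. a x * exp (M * norm x))"
  shows "continuous_on {0..M} (\<lambda>\<kappa>. LINT x|lborel. a x * exp (\<kappa> * h x))"
proof (rule continuous_on_sequentiallyI)
  fix u :: "nat \<Rightarrow> real" and \<kappa> assume u: "\<forall>n. u n \<in> {0..M}" "\<kappa> \<in> {0..M}" "u \<longlonglongrightarrow> \<kappa>"
  show "(\<lambda>n. LINT x|lborel. a x * exp (u n * h x)) \<longlonglongrightarrow> (LINT x|lborel. a x * exp (\<kappa> * h x))"
  proof (rule integral_dominated_convergence[where w = "\<lambda>x. norm (a x * exp (M * norm x))"])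
    show "integrable lborel (\<lambda>x. norm (a x * exp (M * norm x)))"
      using i by (rule integrable_norm)
    show "AE x in lborel. (\<lambda>n. a x * exp (u n * h x)) \<longlonglongrightarrow> a x * exp (\<kappa> * h x)"
      by (intro AE_I2 tendsto_intros u)
    show "AE x in lborel. norm (a x * exp (u n * h x)) \<le> norm (a x * exp (M * norm x))" for n
    proof (intro AE_I2)
      fix x
      have un: "0 \<le> u n" "u n \<le> M" using u(1) by auto
      have "u n * h x \<le> u n * norm x" using un h by (intro mult_left_mono) auto
      also have "\<dots> \<le> M * norm x" using un by (intro mult_right_mono) auto
      finally show "norm (a x * exp (u n * h x)) \<le> norm (a x * exp (M * norm x))"
        by (simp add: abs_mult mult_left_mono)
    qed
  qed measurable
qed

section \<open>Decay of ground states in any dimension\<close>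

text \<open>The last assumption is the eigenvalue equation after the nonlocal term has been expanded
  with \<integral> a = 1. It is required at every point rather than almost everywhere, which makes
  pointwise comparison possible.\<close>

locale ground_state_density =
  fixes a V :: "'a::euclidean_space \<Rightarrow> real" and lam :: real and \<phi> :: "'a \<Rightarrow> real"
  assumes kernel: "dispersal_kernel a" and potential: "admissible_potential V"
    and lam_pos: "0 < lam"
    and \<phi>_cont: "continuous_on UNIV \<phi>" and \<phi>_pos: "0 < \<phi> x" and \<phi>_bounded: "bounded (range \<phi>)"
    and eigen: "(1 + lam - V x) * \<phi> x = (LINT y|lborel. a (x - y) * \<phi> y)"
begin

lemma a_nonneg: "0 \<le> a x"
  and a_cont: "continuous_on UNIV a"
  and a_even: "a (- x) = a x"
  and a_integrable: "integrable lborel a"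
  and a_integral: "(LINT x|lborel. a x) = 1"
  using kernel by (auto simp: dispersal_kernel_def)

lemma V_bounds: "0 \<le> V x" "V x \<le> 1"
  using potential by (auto simp: admissible_potential_def)

lemma V_measurable [measurable]: "V \<in> borel_measurable borel"
  using potential by (auto simp: admissible_potential_def intro: borel_measurable_continuous_onI)

lemma a_measurable [measurable]: "a \<in> borel_measurable borel"
  using a_cont by (rule borel_measurable_continuous_onI)

lemma \<phi>_measurable [measurable]: "\<phi> \<in> borel_measurable borel"
  using \<phi>_cont by (rule borel_measurable_continuous_onI)

lemma \<phi>_bound:
  obtains B where "0 < B" "\<And>x. \<phi> x \<le> B" "\<And>x. \<bar>\<phi> x\<bar> \<le> B"
  using \<phi>_bounded unfolding bounded_pos by (auto intro: order_trans[OF abs_ge_self])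

lemma V_support:
  obtains R where "0 < R" "\<And>x. R < norm x \<Longrightarrow> V x = 0"
proof -
  have "bounded (closure {x. V x \<noteq> 0})"
    using potential by (auto simp: admissible_potential_def intro: compact_imp_bounded)
  then obtain R where "0 < R" "\<forall>x\<in>closure {x. V x \<noteq> 0}. norm x \<le> R"
    unfolding bounded_pos by auto
  then show ?thesis
    using closure_subset[of "{x. V x \<noteq> 0}"] by (intro that[of R]) force+
qed

lemma positive_on_cball:
  fixes w :: "'a \<Rightarrow> real"
  assumes "continuous_on UNIV w" "\<And>x. 0 < w x"
  obtains m where "0 < m" "\<And>x. norm x \<le> R \<Longrightarrow> m \<le> w x"
proof (cases "0 \<le> R")
  case True
  have "\<exists>z\<in>cball 0 R. \<forall>x\<in>cball 0 R. w z \<le> w x"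
    using True by (intro continuous_attains_inf continuous_on_subset[OF assms(1)]) auto
  then obtain z where "\<And>x. norm x \<le> R \<Longrightarrow> w z \<le> w x"
    by (metis mem_cball_0)
  then show ?thesis by (rule that[OF assms(2)])
next
  case False
  \<comment> \<open>For a negative radius no point has to be checked, and any positive constant
    works.\<close>
  then show ?thesis using that[of 1] by (auto dest: order_trans[OF norm_ge_zero])
qed

text \<open>On a ball that contains the support of \<open>V\<close>, the choice
  \<open>K = C / m\<close> makes \<open>K * w\<close> exceed the global bound \<open>C\<close> of
  \<open>\<phi>\<close>. Outside it \<open>V = 0\<close> turns the eigenvalue equation into
  \<open>(1 + lam) * \<phi> = a * \<phi>\<close> (convolution on the right), and the comparison
  principle takes over.\<close>

lemma supersolution_bound:
  assumes w: "continuous_on UNIV w" "\<And>x. 0 < w x" "\<And>x. w x \<le> B"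
    and super: "\<And>x. R \<le> norm x \<Longrightarrow> (LINT y|lborel. a (x - y) * w y) \<le> (1 + lam) * w x"
  obtains K where "0 < K" "\<And>x. \<phi> x \<le> K * w x"
proof -
  obtain R' where R': "\<And>x. R' < norm x \<Longrightarrow> V x = 0" using V_support by metis
  obtain C where C: "0 < C" "\<And>x. \<phi> x \<le> C" "\<And>x. \<bar>\<phi> x\<bar> \<le> C" using \<phi>_bound by metis
  obtain m where m: "0 < m" "\<And>x. norm x \<le> max R R' \<Longrightarrow> m \<le> w x"
    using positive_on_cball[OF w(1,2), of "max R R'"] by metis
  define K where "K = C / m"
  have K: "0 < K" using C m by (simp add: K_def)
  have wm: "w \<in> borel_measurable borel" using w(1) by (rule borel_measurable_continuous_onI)
  have "\<phi> x \<le> K * w x" for x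
  proof (rule convolution_comparison[where A = "cball 0 (max R R')" and lam = lam and f = \<phi> and w = "\<lambda>x. K * w x"])
    show "\<bar>K * w x\<bar> \<le> K * B" for x
      using K w(2)[of x] w(3)[of x] by (simp add: abs_mult)
    show "(1 + lam) * \<phi> x \<le> (LINT y|lborel. a (x - y) * \<phi> y)" if "x \<notin> cball 0 (max R R')" for x
      using eigen[of x] R'[of x] that by simp
    show "(LINT y|lborel. a (x - y) * (K * w y)) \<le> (1 + lam) * (K * w x)" if "x \<notin> cball 0 (max R R')" for x
      using super[of x] K that by (simp add: mult.left_commute[of _ K])
    show "\<phi> x \<le> K * w x" if "x \<in> cball 0 (max R R')" for x
    proof -
      have "K * m \<le> K * w x" using m(2)[of x] that K by (intro mult_left_mono) auto
      then show ?thesis using C(2)[of x] m(1) by (simp add: K_def)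
    qed
  qed (use a_nonneg a_integrable a_integral lam_pos wm C in auto)
  then show ?thesis using K that by metis
qed

text \<open>Since \<open>V \<ge> 0\<close>, \<open>(1 + lam) * \<phi> x\<close> dominates the
  convolution, whose nonnegative integrand may be cut down to the unit ball, where
  \<open>\<phi> \<ge> m\<close>. The parameter \<open>t\<close> stands for whatever lower bound of
  \<open>a\<close> around \<open>x\<close> is at hand, polynomial or exponential.\<close>

lemma kernel_lower_bound:
  obtains k where "0 < k" "\<And>x t. 0 \<le> t \<Longrightarrow> \<forall>y. norm y \<le> 1 \<longrightarrow> t \<le> a (x - y) \<Longrightarrow> k * t \<le> \<phi> x"
proof -
  obtain m where m: "0 < m" "\<And>x. norm x \<le> 1 \<Longrightarrow> m \<le> \<phi> x"
    using positive_on_cball[OF \<phi>_cont \<phi>_pos, of 1] by metis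
  obtain C where C: "\<And>x. \<bar>\<phi> x\<bar> \<le> C" using \<phi>_bound by metis
  define v where "v = measure lborel (cball (0::'a) 1)"
  have v: "0 < v" by (simp add: v_def content_cball)
  define k where "k = m * v / (1 + lam)"
  have "k * t \<le> \<phi> x" if t: "0 \<le> t" "\<forall>y. norm y \<le> 1 \<longrightarrow> t \<le> a (x - y)" for x t
  proof -
    have "t * m * v = (LINT y|lborel. t * m * indicator (cball (0::'a) 1) y)"
      by (simp add: v_def)
    also have "\<dots> \<le> (LINT y|lborel. a (x - y) * \<phi> y)"
    proof (rule integral_mono)
      show "integrable lborel (\<lambda>y::'a. t * m * indicator (cball 0 1) y)"
        using emeasure_lborel_cball_finite[of "0::'a" 1] by simp
      show "integrable lborel (\<lambda>y. a (x - y) * \<phi> y)"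
        by (rule convolution_integrable[OF a_integrable \<phi>_measurable C])
      show "t * m * indicator (cball 0 1) y \<le> a (x - y) * \<phi> y" for y
      proof (cases "norm y \<le> 1")
        case True
        then show ?thesis using t m a_nonneg[of "x - y"] by (auto intro!: mult_mono)
      next
        case False
        then show ?thesis using a_nonneg[of "x - y"] \<phi>_pos[of y] by simp
      qed
    qed
    also have "\<dots> \<le> (1 + lam) * \<phi> x"
      unfolding eigen[symmetric] using V_bounds \<phi>_pos[of x] by (intro mult_right_mono) auto
    finally show ?thesis using lam_pos by (simp add: k_def field_simps)
  qed
  moreover have "0 < k" using m v lam_pos by (simp add: k_def)
  ultimately show ?thesis using that by metis
qed

text \<open>The function \<open>h\<close> is \<open>norm\<close> in general; on the line one of \<open>\<plusminus> z\<close> gives the sharp rate.\<close>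

lemma exponential_upper_bound:
  assumes m: "0 \<le> m"
    and h: "\<And>x. \<exists>h. h \<in> borel_measurable borel \<and> (\<forall>z. norm x \<le> norm (x - z) + h z) \<and>
         integrable lborel (\<lambda>z. a z * exp (m * h z)) \<and> (LINT z|lborel. a z * exp (m * h z)) \<le> 1 + lam"
  obtains K where "0 < K" "\<And>x. \<phi> x \<le> K * exp (- m * norm x)"
proof (rule supersolution_bound)
  show "continuous_on UNIV (\<lambda>x::'a. exp (- m * norm x))" by (intro continuous_intros)
  show "exp (- m * norm x) \<le> 1" for x :: 'a using m by simp
  fix x :: 'a
  obtain h where h: "h \<in> borel_measurable borel" "\<And>z. norm x \<le> norm (x - z) + h z"
    "integrable lborel (\<lambda>z. a z * exp (m * h z))" "(LINT z|lborel. a z * exp (m * h z)) \<le> 1 + lam"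
    using h by metis
  have "(LINT y|lborel. a (x - y) * exp (- m * norm y)) = (LINT z|lborel. a z * exp (- m * norm (x - z)))"
    by (rule integral_convolution_commute) measurable
  also have "\<dots> \<le> (LINT z|lborel. a z * exp (m * h z) * exp (- m * norm x))"
  proof (rule integral_mono)
    show "integrable lborel (\<lambda>z. a z * exp (m * h z) * exp (- m * norm x))" using h by simp
    show "integrable lborel (\<lambda>z. a z * exp (- m * norm (x - z)))"
    proof (rule Bochner_Integration.integrable_bound[OF a_integrable])
      show "AE z in lborel. norm (a z * exp (- m * norm (x - z))) \<le> norm (a z)"
        using m a_nonneg by (intro AE_I2) (simp add: abs_mult mult_left_le)
    qed measurable
    show "a z * exp (- m * norm (x - z)) \<le> a z * exp (m * h z) * exp (- m * norm x)" for z
    proof -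
      have "m * norm x \<le> m * (norm (x - z) + h z)" using m h(2) by (intro mult_left_mono)
      then have "exp (- m * norm (x - z)) \<le> exp (m * h z) * exp (- m * norm x)"
        by (simp add: exp_add[symmetric] algebra_simps)
      then show ?thesis using a_nonneg[of z] by (simp add: mult.assoc mult_left_mono)
    qed
  qed
  also have "\<dots> \<le> (1 + lam) * exp (- m * norm x)"
    using h(4) by simp
  finally show "(LINT y|lborel. a (x - y) * exp (- m * norm y)) \<le> (1 + lam) * exp (- m * norm x)" .
qed (use that in auto)

text \<open>Half of the rate \<open>\<delta>\<close> is spent on integrability. The tilted integral
  is then continuous in \<open>\<kappa>\<close> and equals 1 at \<open>\<kappa> = 0\<close>, hence
  stays below \<open>1 + lam\<close> for some small positive tilt \<open>m\<close>. This makes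
  \<open>exp (- m * norm x)\<close> a barrier, with \<open>h = norm\<close> by the triangle
  inequality.\<close>

theorem exponential_case:
  assumes c: "0 < c" and d: "0 < \<delta>" and a: "\<And>x. a x \<le> c * exp (- \<delta> * norm x)"
  obtains K m where "0 < K" "0 < m" "\<And>x. \<phi> x \<le> K * exp (- m * norm x)"
proof -
  have i: "integrable lborel (\<lambda>x. a x * exp (\<delta> / 2 * norm x))"
  proof (rule Bochner_Integration.integrable_bound)
    show "integrable lborel (\<lambda>x::'a. c * exp (- (\<delta> / 2) * norm x))"
      using integrable_exp_norm[of "\<delta> / 2"] d by (intro integrable_mult_right) auto
    show "AE x in lborel. norm (a x * exp (\<delta> / 2 * norm x)) \<le> norm (c * exp (- (\<delta> / 2) * norm x))"
    proof (intro AE_I2)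
      fix x
      have "a x * exp (\<delta> / 2 * norm x) \<le> c * exp (- \<delta> * norm x) * exp (\<delta> / 2 * norm x)"
        using a by (intro mult_right_mono) auto
      also have "\<dots> = c * exp (- (\<delta> / 2) * norm x)" by (simp add: exp_add[symmetric] mult.assoc)
      finally show "norm (a x * exp (\<delta> / 2 * norm x)) \<le> norm (c * exp (- (\<delta> / 2) * norm x))"
        using a_nonneg[of x] c by (simp add: abs_mult)
    qed
  qed measurable
  have "continuous_on {0..\<delta>/2} (\<lambda>\<kappa>. LINT x|lborel. a x * exp (\<kappa> * norm x))"
    by (rule tilted_integral_continuous[OF _ _ _ i]) auto
  then have "((\<lambda>\<kappa>. LINT x|lborel. a x * exp (\<kappa> * norm x)) \<longlongrightarrow> 1) (at 0 within {0..\<delta>/2})"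
    using d a_integral unfolding continuous_on_def by (auto dest: bspec[of _ _ 0])
  then have "\<forall>\<^sub>F \<kappa> in at 0 within {0..\<delta>/2}. (LINT x|lborel. a x * exp (\<kappa> * norm x)) < 1 + lam"
    using lam_pos by (intro order_tendstoD) auto
  then obtain e where e: "0 < e"
    "\<And>\<kappa>. \<kappa> \<in> {0..\<delta>/2} \<Longrightarrow> \<kappa> \<noteq> 0 \<Longrightarrow> dist \<kappa> 0 < e \<Longrightarrow> (LINT x|lborel. a x * exp (\<kappa> * norm x)) < 1 + lam"
    unfolding eventually_at by auto
  define m where "m = min (\<delta> / 2) (e / 2)"
  have m: "0 < m" "m \<le> \<delta> / 2" "m < e" using d e by (auto simp: m_def)
  have "integrable lborel (\<lambda>x. a x * exp (m * norm x))"
  proof (rule Bochner_Integration.integrable_bound[OF i])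
    show "AE x in lborel. norm (a x * exp (m * norm x)) \<le> norm (a x * exp (\<delta> / 2 * norm x))"
      using mult_right_mono[OF m(2) norm_ge_zero] by (intro AE_I2) (auto simp: abs_mult intro!: mult_left_mono)
  qed measurable
  then have "\<exists>h. h \<in> borel_measurable borel \<and> (\<forall>z. norm x \<le> norm (x - z) + h z) \<and>
         integrable lborel (\<lambda>z. a z * exp (m * h z)) \<and> (LINT z|lborel. a z * exp (m * h z)) \<le> 1 + lam" for x
    using m e(2)[of m] norm_triangle_sub[of x] by (intro exI[of _ norm]) (auto simp: add.commute less_imp_le)
  from exponential_upper_bound[OF _ this] obtain K where "0 < K" "\<And>x. \<phi> x \<le> K * exp (- m * norm x)"
    using m by auto
  then show ?thesis using that m by auto
qed

text \<open>The barrier is \<open>w M\<close>. In its convolution with \<open>a\<close>, the points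
  with \<open>norm (x - y) \<le> \<theta> * norm x\<close> contribute at most
  \<open>(1 + lam / 2) * w M x\<close>, the others at most \<open>C * w M x\<close> times the
  integral of \<open>w M\<close>. Choosing first \<open>\<theta>\<close> small and then
  \<open>M\<close> large keeps the total below \<open>(1 + lam) * w M x\<close>.\<close>

theorem polynomial_case:
  fixes \<beta> :: real
  assumes beta: "0 < \<beta>" and cm: "0 < cm"
    and lower: "\<And>x. cm * (1 + norm x) powr (- \<beta>) \<le> a x"
    and upper: "\<And>x. a x \<le> cp * (1 + norm x) powr (- \<beta>)"
  obtains dm dp where "0 < dm" "dm \<le> dp"
    "\<And>x. dm * (1 + norm x) powr (- \<beta>) \<le> \<phi> x" "\<And>x. \<phi> x \<le> dp * (1 + norm x) powr (- \<beta>)"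
proof -
  define w where "w M x = (M + norm x) powr (- \<beta>)" for M and x :: 'a
  have w_pos: "0 < w M x" if "0 < M" for M x
  proof -
    have "0 < M + norm x" using that norm_ge_zero[of x] by linarith
    then show ?thesis by (simp add: w_def)
  qed
  have wm [measurable]: "w M \<in> borel_measurable borel" for M
    unfolding w_def by measurable
  have w_le: "w M x \<le> w N x" if "0 < N" "N \<le> M" for M N x
    unfolding w_def using that beta by (intro powr_mono2') (auto simp: add_pos_nonneg)
  have w_small: "w M x \<le> M powr (- \<beta>)" if "0 < M" for M x
    unfolding w_def using that beta by (intro powr_mono2') auto
  have cp: "0 < cp"
  proof -
    have "cm * (1 + norm (0::'a)) powr (- \<beta>) \<le> cp * (1 + norm (0::'a)) powr (- \<beta>)"
      using lower upper by (rule order_trans)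
    then show ?thesis using cm by simp
  qed
  \<comment> \<open>The lower bound on the kernel puts \<open>w 1\<close> below the integrable
    function \<open>a / cm\<close>.\<close>
  have w1: "integrable lborel (w 1)"
  proof (rule Bochner_Integration.integrable_bound)
    show "integrable lborel (\<lambda>x. a x / cm)" using a_integrable by simp
    show "AE x in lborel. norm (w 1 x) \<le> norm (a x / cm)"
      using lower cm a_nonneg by (intro AE_I2) (auto simp: w_def field_simps)
  qed simp
  have wi: "integrable lborel (w M)" if "1 \<le> M" for M
  proof (rule Bochner_Integration.integrable_bound[OF w1])
    show "AE x in lborel. norm (w M x) \<le> norm (w 1 x)"
      using w_le[of 1 M] w_pos[of M] w_pos[of 1] that by (intro AE_I2) (auto simp: less_imp_le)
  qed simp
  \<comment> \<open>Enlarging the shift makes the whole integral of the barrier small; this pays for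
    the far region below.\<close>
  have "(\<lambda>n. LINT x|lborel. w (1 + real n) x) \<longlonglongrightarrow> (LINT x|(lborel :: 'a measure). 0)"
  proof (rule integral_dominated_convergence[OF _ _ w1])
    show "AE x in lborel. (\<lambda>n. w (1 + real n) x) \<longlonglongrightarrow> 0"
    proof (intro AE_I2)
      fix x :: 'a
      have "filterlim (\<lambda>n. 1 + real n + norm x) at_top sequentially"
        using filterlim_tendsto_add_at_top[OF tendsto_const filterlim_real_sequentially, of "1 + norm x"]
        by (simp add: ac_simps)
      then show "(\<lambda>n. w (1 + real n) x) \<longlonglongrightarrow> 0"
        unfolding w_def using beta by (intro tendsto_neg_powr) auto
    qed
    show "AE x in lborel. norm (w (1 + real n) x) \<le> w 1 x" for n
      using w_le[of 1 "1 + real n"] w_pos[of "1 + real n"] by (intro AE_I2) (auto simp: less_imp_le)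
  qed auto
  then have I0: "(\<lambda>n. LINT x|lborel. w (1 + real n) x) \<longlonglongrightarrow> 0" by simp
  \<comment> \<open>The surplus \<open>lam\<close> is split in two: this half allows the barrier to
    vary by a factor \<open>(1 - \<theta>) powr (- \<beta>)\<close> over the near region.\<close>
  have "((\<lambda>t. (1 - t) powr (- \<beta>)) \<longlongrightarrow> (1 - 0) powr (- \<beta>)) (at_right 0)"
    by (intro tendsto_intros) auto
  then have "\<forall>\<^sub>F t in at_right 0. (1 - t) powr (- \<beta>) < 1 + lam / 2"
    using lam_pos by (intro order_tendstoD) auto
  moreover have "\<forall>\<^sub>F t in at_right 0. t < (1::real)"
    by (auto simp: eventually_at_right[of 0 1] intro!: exI[of _ 1])
  moreover have "\<forall>\<^sub>F t in at_right 0. 0 < (t::real)"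
    by (rule eventually_at_right_less)
  ultimately have "\<forall>\<^sub>F t in at_right 0. (1 - t) powr (- \<beta>) < 1 + lam / 2 \<and> t < 1 \<and> 0 < t"
    by eventually_elim auto
  then obtain \<theta> :: real where th: "0 < \<theta>" "\<theta> < 1" "(1 - \<theta>) powr (- \<beta>) < 1 + lam / 2"
    using eventually_happens[of _ "at_right (0::real)"] by auto
  \<comment> \<open>Constant of the far region: there
    \<open>1 + norm (x - y) \<ge> \<theta> / 2 * (M + norm x)\<close> as soon as
    \<open>M \<le> norm x\<close>, hence \<open>a (x - y) \<le> C * w M x\<close>. It does not
    depend on \<open>M\<close>, which can therefore be fixed afterwards.\<close>
  define C where "C = cp * (\<theta> / 2) powr (- \<beta>)"
  have C: "0 < C" using cp th by (simp add: C_def)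
  have "\<forall>\<^sub>F n in sequentially. (LINT x|lborel. w (1 + real n) x) < lam / (2 * C)"
    using I0 C lam_pos by (intro order_tendstoD) auto
  then obtain n where n: "(LINT x|lborel. w (1 + real n) x) < lam / (2 * C)"
    by (auto simp: eventually_sequentially)
  define M where "M = 1 + real n"
  have M: "1 \<le> M" "C * (LINT x|lborel. w M x) < lam / 2"
    using n C by (auto simp: M_def field_simps)
  have pt: "a (x - y) * w M y \<le> w M x * ((1 + lam / 2) * a (x - y) + C * w M y)"
    if x: "M \<le> norm x" for x y
  proof (cases "norm (x - y) \<le> \<theta> * norm x")
    case True
    have "norm x \<le> norm (x - y) + norm y" using norm_triangle_sub[of x y] by simp
    then have "(1 - \<theta>) * (M + norm x) \<le> M + norm y"
      using True th M by (simp add: algebra_simps) (smt (verit) mult_nonneg_nonneg)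
    then have "w M y \<le> ((1 - \<theta>) * (M + norm x)) powr (- \<beta>)"
      unfolding w_def using th M beta by (intro powr_mono2') (auto simp: add_pos_nonneg)
    also have "\<dots> = (1 - \<theta>) powr (- \<beta>) * w M x"
      using th M by (simp add: w_def powr_mult)
    also have "\<dots> \<le> (1 + lam / 2) * w M x"
      using th w_pos[of M x] M by (intro mult_right_mono) auto
    finally have "a (x - y) * w M y \<le> a (x - y) * ((1 + lam / 2) * w M x)"
      by (intro mult_left_mono a_nonneg)
    moreover have "0 \<le> w M x * (C * w M y)"
      using C w_pos[of M] M by (simp add: less_imp_le)
    ultimately show ?thesis by (simp add: algebra_simps)
  next
    case False
    have "\<theta> / 2 * (M + norm x) \<le> \<theta> * norm x"
      using th x by (simp add: field_simps)
    then have "\<theta> / 2 * (M + norm x) \<le> 1 + norm (x - y)" using False by simp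
    then have "(1 + norm (x - y)) powr (- \<beta>) \<le> (\<theta> / 2 * (M + norm x)) powr (- \<beta>)"
      using th M beta by (intro powr_mono2') (auto simp: add_pos_nonneg)
    also have "\<dots> = (\<theta> / 2) powr (- \<beta>) * w M x"
      using th M by (subst powr_mult) (auto simp: w_def)
    finally have "cp * (1 + norm (x - y)) powr (- \<beta>) \<le> C * w M x"
      using cp by (simp add: C_def mult.assoc)
    then have "a (x - y) \<le> C * w M x"
      using upper order_trans by blast
    then have "a (x - y) * w M y \<le> C * w M x * w M y"
      using w_pos[of M y] M by (intro mult_right_mono) auto
    moreover have "0 \<le> w M x * ((1 + lam / 2) * a (x - y))"
      using a_nonneg[of "x - y"] lam_pos w_pos[of M x] M by simp
    ultimately show ?thesis by (simp add: algebra_simps)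
  qed
  obtain K where K: "0 < K" "\<And>x. \<phi> x \<le> K * w M x"
  proof (rule supersolution_bound)
    have "continuous_on UNIV (\<lambda>x::'a. (M + norm x) powr (- \<beta>))"
      using M by (intro continuous_intros) (auto simp: add_pos_nonneg less_imp_neq[symmetric])
    then show "continuous_on UNIV (w M)" by (simp add: w_def[abs_def])
    show "0 < w M x" for x using w_pos[of M] M by simp
    show "w M x \<le> M powr (- \<beta>)" for x using w_small M by simp
    fix x :: 'a assume x: "M \<le> norm x"
    have "(LINT y|lborel. a (x - y) * w M y) \<le> (LINT y|lborel. w M x * ((1 + lam / 2) * a (x - y) + C * w M y))"
    proof (rule integral_mono[OF _ _ pt[OF x]])
      show "integrable lborel (\<lambda>y. a (x - y) * w M y)"
        using w_small[of M] w_pos[of M] M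
        by (intro convolution_integrable[OF a_integrable wm, of _ "M powr (- \<beta>)"]) (auto simp: less_imp_le)
      show "integrable lborel (\<lambda>y. w M x * ((1 + lam / 2) * a (x - y) + C * w M y))"
        using wi[OF M(1)] integrable_reflect[OF a_integrable, of x] by simp
    qed
    also have "\<dots> = w M x * ((1 + lam / 2) + C * (LINT y|lborel. w M y))"
      using wi[OF M(1)] integrable_reflect[OF a_integrable, of x] integral_reflect[of a x] a_integral by simp
    also have "\<dots> \<le> w M x * (1 + lam)"
      using M w_pos[of M x] by (intro mult_left_mono) auto
    finally show "(LINT y|lborel. a (x - y) * w M y) \<le> (1 + lam) * w M x" by (simp add: mult.commute)
  qed (use that in auto)
  obtain k where k: "0 < k" "\<And>x t. 0 \<le> t \<Longrightarrow> \<forall>y. norm y \<le> 1 \<longrightarrow> t \<le> a (x - y) \<Longrightarrow> k * t \<le> \<phi> x"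
    using kernel_lower_bound by metis
  \<comment> \<open>The power of 2 comes from \<open>1 + norm (x - y) \<le> 2 * (1 + norm x)\<close>
    for \<open>norm y \<le> 1\<close>.\<close>
  define dm where "dm = k * cm * 2 powr (- \<beta>)"
  have dm: "dm * (1 + norm x) powr (- \<beta>) \<le> \<phi> x" for x
  proof -
    have "k * (cm * (2 * (1 + norm x)) powr (- \<beta>)) \<le> \<phi> x"
    proof (rule k(2); (intro allI impI)?)
      fix y :: 'a assume y: "norm y \<le> 1"
      have "norm (x - y) \<le> norm x + 1" using norm_triangle_ineq4[of x y] y by simp
      then have "1 + norm (x - y) \<le> 2 * (1 + norm x)" by (smt (verit) norm_ge_zero)
      then have "(2 * (1 + norm x)) powr (- \<beta>) \<le> (1 + norm (x - y)) powr (- \<beta>)"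
        using beta by (intro powr_mono2') (auto simp: add_pos_nonneg)
      then have "cm * (2 * (1 + norm x)) powr (- \<beta>) \<le> cm * (1 + norm (x - y)) powr (- \<beta>)"
        using cm by simp
      then show "cm * (2 * (1 + norm x)) powr (- \<beta>) \<le> a (x - y)" using lower order_trans by blast
    next
      show "0 \<le> cm * (2 * (1 + norm x)) powr - \<beta>" using cm by simp
    qed
    moreover have "(2 * (1 + norm x)) powr (- \<beta>) = 2 powr (- \<beta>) * (1 + norm x) powr (- \<beta>)"
      by (subst powr_mult) auto
    ultimately show ?thesis by (simp add: dm_def mult.assoc)
  qed
  have dp: "\<phi> x \<le> K * (1 + norm x) powr (- \<beta>)" for x
  proof -
    have "K * w M x \<le> K * w 1 x" using w_le[of 1 M] M K by simp
    then show ?thesis using K(2)[of x] by (simp add: w_def)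
  qed
  have "0 < dm" using k cm by (simp add: dm_def)
  moreover have "dm \<le> K" using order_trans[OF dm[of 0] dp[of 0]] by simp
  ultimately show ?thesis using that dm dp by metis
qed

end

text \<open>The convolution \<open>J\<close> of \<open>a\<close> with \<open>\<psi>\<close> is
  bounded, because both factors are square integrable, and it ignores null sets. So the quotient
  \<open>J x / (1 + lam - V x)\<close> agrees with \<open>\<psi>\<close> almost everywhere, and
  using it as \<open>\<phi>\<close> makes the equation hold at every point.\<close>

lemma ground_state_density_exists:
  fixes a V \<psi> :: "'a::euclidean_space \<Rightarrow> real"
  assumes ker: "dispersal_kernel a" and pot: "admissible_potential V" and gs: "ground_state a V lam \<psi>"
  obtains \<phi> where "continuous_representative \<phi> \<psi>" "ground_state_density a V lam \<phi>"
proof -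
  have a: "\<And>x. 0 \<le> a x" "continuous_on UNIV a" "integrable lborel a" "(LINT x|lborel. a x) = 1"
    using ker by (auto simp: dispersal_kernel_def)
  have [measurable]: "a \<in> borel_measurable borel" using a(2) by (rule borel_measurable_continuous_onI)
  have "bounded (range a)" using ker by (simp add: dispersal_kernel_def)
  then obtain A where A: "0 < A" "\<And>x. a x \<le> A"
    unfolding bounded_pos by (auto intro: order_trans[OF abs_ge_self])
  have V: "continuous_on UNIV V" "\<And>x. 0 \<le> V x" "\<And>x. V x \<le> 1"
    using pot by (auto simp: admissible_potential_def)
  have lam: "0 < lam" and pos: "AE x in lborel. 0 < \<psi> x" and \<psi>2: "integrable lborel (\<lambda>x. (\<psi> x)\<^sup>2)"
    and op: "AE x in lborel. nonlocal_op a V \<psi> x = lam * \<psi> x" and \<psi>m [measurable]: "\<psi> \<in> borel_measurable borel"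
    using gs by (auto simp: ground_state_def principal_eigenvalue_def L2_eigenfunction_def L2_fun_def)
  have den: "0 < 1 + lam - V x" "lam \<le> 1 + lam - V x" for x using V(3)[of x] lam by linarith+
  \<comment> \<open>A bounded integrable kernel is square integrable: the square of \<open>a\<close>
    is at most \<open>A * a\<close>.\<close>
  have a2: "integrable lborel (\<lambda>x. (a x)\<^sup>2)"
  proof (rule Bochner_Integration.integrable_bound)
    show "integrable lborel (\<lambda>x. A * a x)" using a(3) by simp
    show "AE x in lborel. norm ((a x)\<^sup>2) \<le> norm (A * a x)"
      using a(1) A by (intro AE_I2) (auto simp: power2_eq_square abs_mult intro: mult_right_mono)
  qed measurable
  define J where "J x = (LINT y|lborel. a (x - y) * \<psi> y)" for x
  have sq: "\<bar>s * t\<bar> \<le> s\<^sup>2 + t\<^sup>2" for s t :: real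
  proof -
    have "2 * (\<bar>s\<bar> * \<bar>t\<bar>) \<le> s\<^sup>2 + t\<^sup>2" using sum_squares_bound[of "\<bar>s\<bar>" "\<bar>t\<bar>"] by (simp add: mult.assoc)
    moreover have "0 \<le> \<bar>s\<bar> * \<bar>t\<bar>" by simp
    ultimately show ?thesis unfolding abs_mult by linarith
  qed
  have sqi: "integrable lborel (\<lambda>y. (a (x - y))\<^sup>2 + (\<psi> y)\<^sup>2)" for x
    using integrable_reflect[OF a2, of x] \<psi>2 by simp
  have Ji: "integrable lborel (\<lambda>y. a (x - y) * \<psi> y)" for x
    by (rule Bochner_Integration.integrable_bound[OF sqi[of x]]) (auto intro!: AE_I2 sq)
  define C where "C = (LINT x|lborel. (a x)\<^sup>2) + (LINT x|lborel. (\<psi> x)\<^sup>2)"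
  have JC: "\<bar>J x\<bar> \<le> C" for x
  proof -
    have "\<bar>J x\<bar> \<le> (LINT y|lborel. \<bar>a (x - y) * \<psi> y\<bar>)"
      unfolding J_def by (rule integral_abs_bound)
    also have "\<dots> \<le> (LINT y|lborel. (a (x - y))\<^sup>2 + (\<psi> y)\<^sup>2)"
      by (intro integral_mono integrable_abs Ji sqi sq)
    also have "\<dots> = C"
      using integrable_reflect[OF a2, of x] \<psi>2 integral_reflect[of "\<lambda>x. (a x)\<^sup>2" x] by (simp add: C_def)
    finally show ?thesis .
  qed
  have eig: "AE x in lborel. \<psi> x = J x / (1 + lam - V x)"
    using op
  proof eventually_elim
    case (elim x)
    have "(LINT y|lborel. a (x - y) * (\<psi> y - \<psi> x)) = J x - \<psi> x"
      using Ji[of x] integrable_reflect[OF a(3), of x] integral_reflect[of a x] a(4)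
      by (simp add: J_def right_diff_distrib)
    then show ?case using elim den(1)[of x] by (simp add: nonlocal_op_def field_simps)
  qed
  have quot: "\<bar>J x / (1 + lam - V x)\<bar> \<le> C / lam" for x
  proof -
    have "\<bar>J x / (1 + lam - V x)\<bar> = \<bar>J x\<bar> / (1 + lam - V x)" using den(1)[of x] by (simp add: abs_divide)
    also have "\<dots> \<le> C / lam"
      by (rule frac_le) (use JC[of x] den(2)[of x] lam in \<open>linarith+\<close>)
    finally show ?thesis .
  qed
  \<comment> \<open>Truncation at the bound of the quotient changes \<open>\<psi>\<close> only on a
    null set, but yields a function bounded everywhere, as the continuity of the convolution
    requires.\<close>
  define \<psi>' where "\<psi>' x = max (- (C / lam)) (min (C / lam) (\<psi> x))" for x
  have [measurable]: "\<psi>' \<in> borel_measurable borel" unfolding \<psi>'_def by measurable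
  have "AE x in lborel. \<psi>' x = \<psi> x"
    using eig
  proof eventually_elim
    case (elim x)
    have "- (C / lam) \<le> \<psi> x" "\<psi> x \<le> C / lam" using quot[of x] unfolding elim abs_le_iff by linarith+
    then show ?case by (simp add: \<psi>'_def)
  qed
  then have J': "J x = (LINT y|lborel. a (x - y) * \<psi>' y)" for x
    unfolding J_def by (intro integral_cong_AE) (auto elim: eventually_mono)
  have "0 \<le> C / lam" using quot[of 0] by linarith
  then have "continuous_on UNIV J"
    unfolding J'[abs_def]
    by (intro convolution_continuous[where B = "C / lam", OF a(1-3)]) (auto simp: \<psi>'_def)
  define \<phi> where "\<phi> x = J x / (1 + lam - V x)" for x
  have \<phi>c: "continuous_on UNIV \<phi>"
    unfolding \<phi>_def using \<open>continuous_on UNIV J\<close> V(1) den(1)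
    by (intro continuous_intros) (auto simp: less_imp_neq[symmetric])
  have \<phi>\<psi>: "AE x in lborel. \<phi> x = \<psi> x" using eig by (auto simp: \<phi>_def elim: eventually_mono)
  have [measurable]: "\<phi> \<in> borel_measurable borel" using \<phi>c by (rule borel_measurable_continuous_onI)
  \<comment> \<open>If \<open>J x\<close> vanished, positivity of \<open>\<psi>\<close> would force
    \<open>a (x - y) = 0\<close> for almost every \<open>y\<close>, contradicting total mass
    1.\<close>
  have J_pos: "0 < J x" for x
  proof -
    have nn: "AE y in lborel. 0 \<le> a (x - y) * \<psi> y"
      using pos by eventually_elim (simp add: a(1))
    have "J x \<noteq> 0"
    proof
      assume "J x = 0"
      then have "AE y in lborel. a (x - y) * \<psi> y = 0"
        unfolding J_def using integral_nonneg_eq_0_iff_AE[OF Ji nn] by simp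
      then have "AE y in lborel. a (x - y) = 0"
        using pos by eventually_elim auto
      then have "(LINT y|lborel. a (x - y)) = 0" by (rule integral_eq_zero_AE)
      then show False using integral_reflect[of a x] a(4) by simp
    qed
    moreover have "0 \<le> J x" unfolding J_def by (rule integral_nonneg_AE[OF nn])
    ultimately show ?thesis by simp
  qed
  have "ground_state_density a V lam \<phi>"
  proof unfold_locales
    show "0 < \<phi> x" for x using J_pos den by (simp add: \<phi>_def)
    show "bounded (range \<phi>)" using quot by (intro boundedI[of _ "C / lam"]) (auto simp: \<phi>_def)
    show "(1 + lam - V x) * \<phi> x = (LINT y|lborel. a (x - y) * \<phi> y)" for x
    proof -
      have "J x = (LINT y|lborel. a (x - y) * \<phi> y)"
        unfolding J_def using \<phi>\<psi> by (intro integral_cong_AE) (auto elim: eventually_mono)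
      then show ?thesis using den(1)[of x] by (simp add: \<phi>_def)
    qed
  qed (fact ker pot lam \<phi>c)+
  moreover have "continuous_representative \<phi> \<psi>"
    using \<phi>c \<phi>\<psi> by (simp add: continuous_representative_def)
  ultimately show ?thesis using that by blast
qed

section \<open>A renewal theorem on the line\<close>

text \<open>Failure on the whole half-line would include the interval \<open>{c..c+1}\<close>, which
  is not a null set.\<close>

lemma AE_lborel_unbounded:
  fixes P :: "real \<Rightarrow> bool"
  assumes "AE y in lborel. P y"
  shows "\<exists>y\<ge>c. P y"
proof (rule ccontr)
  assume "\<not> (\<exists>y\<ge>c. P y)"
  then have "AE y in lborel. y \<notin> {c..c+1}"
    using assms by (auto elim!: eventually_mono)
  then have "emeasure lborel {c..c+1} = 0"
    by (subst (asm) AE_iff_measurable[where N = "{c..c+1}"]) auto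
  then show False by simp
qed

text \<open>The primitive of \<open>f\<close> normalised at minus infinity. The integral defaults to
  0 when \<open>f\<close> is not integrable on the half-line, so \<open>left_integral_diff\<close>
  assumes integrability up to 0.\<close>

definition left_integral :: "(real \<Rightarrow> real) \<Rightarrow> real \<Rightarrow> real" where
  "left_integral f x = (LINT s|lborel. indicator {..x} s * f s)"

lemma left_integral_measurable [measurable]:
  assumes [measurable]: "f \<in> borel_measurable borel"
  shows "left_integral f \<in> borel_measurable borel"
proof -
  have "left_integral f = (\<lambda>x. LINT s|lborel. (if s \<le> x then f s else 0))"
    unfolding left_integral_def by (auto simp: fun_eq_iff intro!: Bochner_Integration.integral_cong)
  then show ?thesis by simp
qed

text \<open>Moving the endpoint from 0 to \<open>x\<close> affects only a bounded interval, on which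
  \<open>f\<close> is bounded.\<close>

lemma left_integrable:
  fixes f :: "real \<Rightarrow> real"
  assumes fm [measurable]: "f \<in> borel_measurable borel" and fB: "\<And>x. \<bar>f x\<bar> \<le> B"
    and i: "integrable lborel (\<lambda>s. indicator {..0} s * f s)"
  shows "integrable lborel (\<lambda>s. indicator {..x} s * f s)"
proof (rule Bochner_Integration.integrable_bound)
  show "integrable lborel (\<lambda>s. \<bar>indicator {..0} s * f s\<bar> + B * indicator {0..\<bar>x\<bar>} s)"
    using i by (intro Bochner_Integration.integrable_add integrable_abs) auto
  have "0 \<le> B" using fB[of 0] by simp
  then show "AE s in lborel. norm (indicator {..x} s * f s) 
      \<le> norm (\<bar>indicator {..0} s * f s\<bar> + B * indicator {0..\<bar>x\<bar>} s)"
    using fB by (intro AE_I2) (auto simp: indicator_def)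
qed measurable

text \<open>The difference of indicators is the signed indicator of the interval between 0 and
  \<open>y\<close>, so one formula serves both signs of \<open>y\<close>. With
  \<open>f (x - t)\<close> under the integral, \<open>x\<close> can tend to infinity while the
  domain of integration stays fixed.\<close>

lemma left_integral_diff:
  fixes f :: "real \<Rightarrow> real"
  assumes fm [measurable]: "f \<in> borel_measurable borel" and fB: "\<And>x. \<bar>f x\<bar> \<le> B"
    and i: "integrable lborel (\<lambda>s. indicator {..0} s * f s)"
  shows "left_integral f x - left_integral f (x - y)
      = (LINT t|lborel. (indicator {0..} t - indicator {y..} t) * f (x - t))"
    and "\<bar>left_integral f x - left_integral f (x - y)\<bar> \<le> B * \<bar>y\<bar>"
proof -
  note li = left_integrable[OF assms]
  have "left_integral f x - left_integral f (x - y)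
      = (LINT s|lborel. (indicator {..x} s - indicator {..x - y} s) * f s)"
    using li by (simp add: left_integral_def left_diff_distrib)
  also have "\<dots> = (LINT t|lborel. (indicator {..x} (x - t) - indicator {..x - y} (x - t)) * f (x - t))"
    by (rule integral_reflect[symmetric]) measurable
  also have "\<dots> = (LINT t|lborel. (indicator {0..} t - indicator {y..} t) * f (x - t))"
    by (intro Bochner_Integration.integral_cong) (auto simp: indicator_def)
  finally show eq: "left_integral f x - left_integral f (x - y)
      = (LINT t|lborel. (indicator {0..} t - indicator {y..} t) * f (x - t))" .
  have B: "0 \<le> B" using fB[of 0] by simp
  have bd: "\<bar>(indicator {0..} t - indicator {y..} t) * f (x - t)\<bar> \<le> B * indicator {min 0 y..max 0 y} t" for t
    using fB[of "x - t"] B by (auto simp: indicator_def)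
  have int_bd: "integrable lborel (\<lambda>t. B * indicator {min 0 y..max 0 y} t)"
    by (intro integrable_mult_right) auto
  have "\<bar>LINT t|lborel. (indicator {0..} t - indicator {y..} t) * f (x - t)\<bar>
      \<le> (LINT t|lborel. \<bar>(indicator {0..} t - indicator {y..} t) * f (x - t)\<bar>)"
    by (rule integral_abs_bound)
  also have "\<dots> \<le> (LINT t|lborel. B * indicator {min 0 y..max 0 y} t)"
  proof (rule integral_mono)
    show "integrable lborel (\<lambda>t. \<bar>(indicator {0..} t - indicator {y..} t) * f (x - t)\<bar>)"
      using bd B by (intro Bochner_Integration.integrable_bound[OF int_bd] AE_I2) auto
  qed (use bd int_bd in auto)
  also have "\<dots> = B * \<bar>y\<bar>" by (auto simp: min_def max_def)
  finally show "\<bar>left_integral f x - left_integral f (x - y)\<bar> \<le> B * \<bar>y\<bar>" by (simp add: eq)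
qed

lemma left_integral_shift:
  fixes f :: "real \<Rightarrow> real"
  assumes fm [measurable]: "f \<in> borel_measurable borel"
  shows "(LINT s|lborel. indicator {..x} s * f (s - y)) = left_integral f (x - y)"
    and "integrable lborel (\<lambda>s. indicator {..x - y} s * f s) \<Longrightarrow>
      integrable lborel (\<lambda>s. indicator {..x} s * f (s - y))"
proof -
  have eq: "(\<lambda>s. indicator {..x - y} (- y + 1 * s) * f (- y + 1 * s)) = (\<lambda>s. indicator {..x} s * f (s - y))"
    by (auto simp: indicator_def fun_eq_iff)
  show "(LINT s|lborel. indicator {..x} s * f (s - y)) = left_integral f (x - y)"
    using lborel_integral_real_affine[of 1 "\<lambda>s. indicator {..x - y} s * f s" "- y"]
    unfolding eq left_integral_def by simp
  show "integrable lborel (\<lambda>s. indicator {..x} s * f (s - y))"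
    if "integrable lborel (\<lambda>s. indicator {..x - y} s * f s)"
    using lborel_integrable_real_affine[OF that, of 1 "- y"] unfolding eq by simp
qed

text \<open>\<open>S\<close> is the upper limit at infinity, defined as the infimum of the eventual
  upper bounds. No number \<open>S - 1 / (n + 1)\<close> is such a bound, so it is exceeded
  somewhere beyond \<open>n\<close>; these points form the sequence.\<close>

lemma limsup_sequence:
  fixes u :: "real \<Rightarrow> real"
  assumes "\<And>x. \<bar>u x\<bar> \<le> B"
  obtains S xs where "filterlim xs at_top sequentially" "(\<lambda>n. u (xs n)) \<longlonglongrightarrow> S"
    "\<And>e. 0 < e \<Longrightarrow> \<forall>\<^sub>F x in at_top. u x \<le> S + e"
proof -
  define A where "A = {s. \<forall>\<^sub>F x in at_top. u x \<le> s}"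
  define S where "S = Inf A"
  have BA: "B \<in> A" using assms by (auto simp: A_def abs_le_iff)
  have bdd: "bdd_below A"
  proof (rule bdd_belowI)
    fix s assume "s \<in> A"
    then obtain x where "u x \<le> s"
      using eventually_happens[of _ "at_top :: real filter"] by (auto simp: A_def)
    then show "- B \<le> s" using assms[of x] by linarith
  qed
  have up: "\<forall>\<^sub>F x in at_top. u x \<le> S + e" if e: "0 < e" for e
  proof -
    have "Inf A < S + e" using e by (simp add: S_def)
    then obtain s where "s \<in> A" "s < S + e" using cInf_lessD[of A] BA by auto
    then show ?thesis by (auto simp: A_def elim: eventually_mono)
  qed
  have "\<exists>x\<ge>real n. S - 1 / real (Suc n) < u x" for n
  proof (rule ccontr)
    assume "\<not> (\<exists>x\<ge>real n. S - 1 / real (Suc n) < u x)"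
    then have "S - 1 / real (Suc n) \<in> A"
      unfolding A_def eventually_at_top_linorder by (auto simp: not_less intro!: exI[of _ "real n"])
    then have "S \<le> S - 1 / real (Suc n)" unfolding S_def by (rule cInf_lower[OF _ bdd])
    then show False by simp
  qed
  then obtain xs where xs: "\<And>n. real n \<le> xs n" "\<And>n. S - 1 / real (Suc n) < u (xs n)" by metis
  have top: "filterlim xs at_top sequentially"
    by (rule filterlim_at_top_mono[OF filterlim_real_sequentially]) (simp add: xs(1))
  have "(\<lambda>n. u (xs n)) \<longlonglongrightarrow> S"
  proof (rule LIMSEQ_I)
    fix e :: real assume e: "0 < e"
    have "(\<lambda>n. S - 1 / real (Suc n)) \<longlonglongrightarrow> S - 0"
      by (intro tendsto_intros LIMSEQ_Suc lim_1_over_n)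
    then have "\<forall>\<^sub>F n in sequentially. S - e < S - 1 / real (Suc n)"
      using e by (intro order_tendstoD) auto
    moreover have "\<forall>\<^sub>F n in sequentially. u (xs n) \<le> S + e / 2"
      using eventually_compose_filterlim[OF up top, of "e / 2"] e by simp
    ultimately have "\<forall>\<^sub>F n in sequentially. norm (u (xs n) - S) < e"
    proof eventually_elim
      case (elim n)
      then show ?case using xs(2)[of n] e unfolding real_norm_def abs_less_iff by linarith
    qed
    then show "\<exists>N. \<forall>n\<ge>N. norm (u (xs n) - S) < e" by (simp add: eventually_sequentially)
  qed
  then show ?thesis using that top up by metis
qed

text \<open>The assumptions are stable under replacing \<open>u\<close> and \<open>g\<close> by
  their negatives, which lets the upper limit argument serve for the lower limit too. Positivity of
  \<open>p\<close> is asked only for \<open>R \<le> \<bar>y\<bar>\<close>, because the logarithmic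
  decay of the kernel gives it only far out. The condition on the left half-line makes the primitive
  of \<open>u\<close> meaningful.\<close>

locale renewal =
  fixes p u g :: "real \<Rightarrow> real" and B R :: real
  assumes p_nonneg: "0 \<le> p y" and p_integrable: "integrable lborel p"
    and p_integral: "(LINT y|lborel. p y) = 1"
    and p_mean: "integrable lborel (\<lambda>y. y * p y)"
    and R_nonneg: "0 \<le> R" and p_pos: "R \<le> \<bar>y\<bar> \<Longrightarrow> 0 < p y"
    and u_measurable [measurable]: "u \<in> borel_measurable borel"
    and u_bound: "\<bar>u x\<bar> \<le> B"
    and u_left: "integrable lborel (\<lambda>s. indicator {..0} s * u s)"
    and g_integrable: "integrable lborel g" and g_vanishes: "(g \<longlongrightarrow> 0) at_top"
    and renewal_eq: "u x = (LINT y|lborel. p y * u (x - y)) + g x"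
begin

lemma p_measurable [measurable]: "p \<in> borel_measurable borel"
  using borel_measurable_integrable[OF p_integrable] by simp

lemma g_measurable [measurable]: "g \<in> borel_measurable borel"
  using borel_measurable_integrable[OF g_integrable] by simp

lemma p_times_integrable:
  assumes [measurable]: "f \<in> borel_measurable borel" and "\<And>y. \<bar>f y\<bar> \<le> C"
  shows "integrable lborel (\<lambda>y. p y * f y)"
proof (rule Bochner_Integration.integrable_bound)
  show "integrable lborel (\<lambda>y. p y * C)" using p_integrable by simp
  show "AE y in lborel. norm (p y * f y) \<le> norm (p y * C)"
    using assms(2) p_nonneg abs_ge_self[of C]
    by (intro AE_I2) (auto simp: abs_mult intro!: mult_left_mono intro: order_trans)
qed measurable

text \<open>By the renewal equation and \<open>g \<longlonglongrightarrow> 0\<close>, the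
  \<open>p\<close>-average of \<open>S - u (xs n - y)\<close> tends to 0. The overshoot of
  \<open>u\<close> above \<open>S\<close> has vanishing \<open>p\<close>-average by dominated
  convergence. Hence the weighted differences tend to 0 in L1, and a subsequence does so almost
  everywhere.\<close>

lemma approach_supremum:
  assumes top: "filterlim xs at_top sequentially" and lim: "(\<lambda>n. u (xs n)) \<longlonglongrightarrow> S"
    and up: "\<And>e. 0 < e \<Longrightarrow> \<forall>\<^sub>F x in at_top. u x \<le> S + e"
  obtains r :: "nat \<Rightarrow> nat" where "strict_mono r"
    "AE y in lborel. R \<le> \<bar>y\<bar> \<longrightarrow> (\<lambda>n. u (xs (r n) - y)) \<longlonglongrightarrow> S"
proof -
  have Si: "integrable lborel (\<lambda>y. p y * (S - u (x - y)))" for x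
    using u_bound by (intro p_times_integrable[of _ "\<bar>S\<bar> + B"])
      (auto intro!: order_trans[OF abs_triangle_ineq4])
  have pm_bd: "\<bar>max 0 (u (x - y) - S)\<bar> \<le> \<bar>S\<bar> + B" for x y
    using u_bound[of "x - y"] by (auto simp: max_def)
  have pm: "integrable lborel (\<lambda>y. p y * max 0 (u (x - y) - S))" for x
    by (rule p_times_integrable[OF _ pm_bd]) measurable
  have "(\<lambda>n. S - (u (xs n) - g (xs n))) \<longlonglongrightarrow> S - (S - 0)"
    by (intro tendsto_intros lim filterlim_compose[OF g_vanishes top])
  moreover have "(LINT y|lborel. p y * (S - u (x - y))) = S - (u x - g x)" for x
  proof -
    have "(LINT y|lborel. p y * (S - u (x - y))) = (LINT y|lborel. p y * S) - (LINT y|lborel. p y * u (x - y))"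
      using p_integrable u_bound p_times_integrable[of "\<lambda>y. u (x - y)" B] by (simp add: right_diff_distrib)
    then show ?thesis using renewal_eq[of x] p_integral by simp
  qed
  ultimately have l1: "(\<lambda>n. LINT y|lborel. p y * (S - u (xs n - y))) \<longlonglongrightarrow> 0" by simp
  have "(\<lambda>n. LINT y|lborel. p y * max 0 (u (xs n - y) - S)) \<longlonglongrightarrow> (LINT y|(lborel :: real measure). 0)"
  proof (rule integral_dominated_convergence[where w = "\<lambda>y. p y * (\<bar>S\<bar> + B)"])
    show "AE y in lborel. (\<lambda>n. p y * max 0 (u (xs n - y) - S)) \<longlonglongrightarrow> 0"
    proof (intro AE_I2 tendsto_mult_right_zero)
      fix y
      have top': "filterlim (\<lambda>n. xs n - y) at_top sequentially"
        using filterlim_tendsto_add_at_top[OF tendsto_const top, of "- y"] by simp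
      show "(\<lambda>n. max 0 (u (xs n - y) - S)) \<longlonglongrightarrow> 0"
      proof (rule LIMSEQ_I)
        fix e :: real assume e: "0 < e"
        have "\<forall>\<^sub>F n in sequentially. u (xs n - y) \<le> S + e / 2"
          using eventually_compose_filterlim[OF up top', of "e / 2"] e by simp
        then show "\<exists>N. \<forall>n\<ge>N. norm (max 0 (u (xs n - y) - S) - 0) < e"
          using e by (fastforce simp: eventually_sequentially max_def)
      qed
    qed
    show "AE y in lborel. norm (p y * max 0 (u (xs n - y) - S)) \<le> p y * (\<bar>S\<bar> + B)" for n
      using pm_bd p_nonneg by (intro AE_I2) (simp add: abs_mult mult_left_mono)
  qed (use p_integrable in auto)
  then have l2: "(\<lambda>n. LINT y|lborel. p y * max 0 (u (xs n - y) - S)) \<longlonglongrightarrow> 0" by simp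
  \<comment> \<open>An absolute value is the signed value plus twice its negative part; this turns
    convergence of averages into L1 convergence.\<close>
  have abs_eq: "norm (p y * (S - u (x - y))) = p y * (S - u (x - y)) + 2 * (p y * max 0 (u (x - y) - S))" for x y
  proof -
    have "\<bar>S - u (x - y)\<bar> = (S - u (x - y)) + 2 * max 0 (u (x - y) - S)" by (simp add: max_def)
    then have "norm (p y * (S - u (x - y))) = p y * ((S - u (x - y)) + 2 * max 0 (u (x - y) - S))"
      using p_nonneg[of y] by (simp add: abs_mult)
    then show ?thesis by (simp add: algebra_simps)
  qed
  have "(\<lambda>n. (LINT y|lborel. p y * (S - u (xs n - y))) + 2 * (LINT y|lborel. p y * max 0 (u (xs n - y) - S)))
      \<longlonglongrightarrow> 0 + 2 * 0"
    by (intro tendsto_intros l1 l2)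
  then have "(\<lambda>n. LINT y|lborel. norm (p y * (S - u (xs n - y)))) \<longlonglongrightarrow> 0"
    unfolding abs_eq using Si pm by simp
  from tendsto_L1_AE_subseq[OF Si this] obtain r where r: "strict_mono r"
    "AE y in lborel. (\<lambda>n. p y * (S - u (xs (r n) - y))) \<longlonglongrightarrow> 0" by auto
  \<comment> \<open>Convergence of \<open>p y * (S - u (xs (r n) - y))\<close> says something about
    \<open>u\<close> only where one can divide by \<open>p y\<close>.\<close>
  have "AE y in lborel. R \<le> \<bar>y\<bar> \<longrightarrow> (\<lambda>n. u (xs (r n) - y)) \<longlonglongrightarrow> S"
    using r(2)
  proof eventually_elim
    case (elim y)
    show ?case
    proof
      assume "R \<le> \<bar>y\<bar>"
      then have "0 < p y" by (rule p_pos)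
      then have "(\<lambda>n. S - (p y * (S - u (xs (r n) - y))) / p y) \<longlonglongrightarrow> S - 0 / p y"
        by (intro tendsto_intros elim) auto
      then show "(\<lambda>n. u (xs (r n) - y)) \<longlonglongrightarrow> S" using \<open>0 < p y\<close> by simp
    qed
  qed
  then show ?thesis using that r(1) by blast
qed

text \<open>One extraction controls only the \<open>y\<close> with \<open>R \<le> |y|\<close>; a second one, started from a translate by
  \<open>w \<ge> 2 R\<close>, covers the remaining \<open>y\<close>.\<close>

lemma translates_converge:
  assumes top: "filterlim xs at_top sequentially" and lim: "(\<lambda>n. u (xs n)) \<longlonglongrightarrow> S"
    and up: "\<And>e. 0 < e \<Longrightarrow> \<forall>\<^sub>F x in at_top. u x \<le> S + e"
  obtains ys :: "nat \<Rightarrow> real" where "filterlim ys at_top sequentially"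
    "AE y in lborel. (\<lambda>n. u (ys n - y)) \<longlonglongrightarrow> S"
proof -
  obtain r where r: "strict_mono r"
    "AE y in lborel. R \<le> \<bar>y\<bar> \<longrightarrow> (\<lambda>n. u (xs (r n) - y)) \<longlonglongrightarrow> S"
    using approach_supremum[OF assms] by blast
  \<comment> \<open>A good translate exists arbitrarily far out. With \<open>w \<ge> 2 * R\<close>,
    every \<open>y\<close> with \<open>\<bar>y\<bar> < R\<close> satisfies
    \<open>R \<le> \<bar>w + y\<bar>\<close>, so the first extraction applies at
    \<open>w + y\<close>.\<close>
  obtain w where w: "2 * R \<le> w" "R \<le> \<bar>w\<bar> \<longrightarrow> (\<lambda>n. u (xs (r n) - w)) \<longlonglongrightarrow> S"
    using AE_lborel_unbounded[OF r(2), of "2 * R"] by auto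
  have top1: "filterlim (\<lambda>n. xs (r n)) at_top sequentially"
    using filterlim_compose[OF top filterlim_subseq[OF r(1)]] .
  have top2: "filterlim (\<lambda>n. xs (r n) - w) at_top sequentially"
    using filterlim_tendsto_add_at_top[OF tendsto_const top1, of "- w"] by simp
  obtain r' where r': "strict_mono r'"
    "AE y in lborel. R \<le> \<bar>y\<bar> \<longrightarrow> (\<lambda>n. u (xs (r (r' n)) - w - y)) \<longlonglongrightarrow> S"
    using approach_supremum[OF top2 _ up] w R_nonneg by auto
  \<comment> \<open>Two reflections compose to the translation \<open>y \<mapsto> w + y\<close>,
    which transports the almost-everywhere statement.\<close>
  have "AE y in lborel. R \<le> \<bar>0 - (- w - y)\<bar> \<longrightarrow> (\<lambda>n. u (xs (r n) - (0 - (- w - y)))) \<longlonglongrightarrow> S"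
    by (intro AE_reflect[of "\<lambda>y. R \<le> \<bar>0 - y\<bar> \<longrightarrow> (\<lambda>n. u (xs (r n) - (0 - y))) \<longlonglongrightarrow> S"]
          AE_reflect[of "\<lambda>y. R \<le> \<bar>y\<bar> \<longrightarrow> (\<lambda>n. u (xs (r n) - y)) \<longlonglongrightarrow> S"] r(2))
  then have "AE y in lborel. (\<lambda>n. u (xs (r (r' n)) - w - y)) \<longlonglongrightarrow> S"
    using r'(2)
  proof eventually_elim
    case (elim y)
    show ?case
    proof (cases "R \<le> \<bar>y\<bar>")
      case True
      then show ?thesis using elim(2) by simp
    next
      case False
      then have "R \<le> \<bar>0 - (- w - y)\<bar>" using w(1) R_nonneg by linarith
      then have "(\<lambda>n. u (xs (r n) - (0 - (- w - y)))) \<longlonglongrightarrow> S" using elim(1) by blast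
      from LIMSEQ_subseq_LIMSEQ[OF this r'(1)] show ?thesis by (simp add: o_def algebra_simps)
    qed
  qed
  moreover have "filterlim (\<lambda>n. xs (r (r' n)) - w) at_top sequentially"
    using filterlim_compose[OF top2 filterlim_subseq[OF r'(1)]] .
  ultimately show ?thesis using that[of "\<lambda>n. xs (r (r' n)) - w"] by simp
qed

text \<open>Integrate the renewal equation over \<open>{..x}\<close> and exchange the integrals: the
  convolution becomes the \<open>p\<close>-average of the shifted primitives of \<open>u\<close>,
  and \<integral> p = 1 lets the primitive at \<open>x\<close> be moved under the same
  average.\<close>

lemma balance:
  "(LINT y|lborel. p y * (left_integral u x - left_integral u (x - y))) = left_integral g x"
proof -
  have B: "0 \<le> B" using u_bound[of 0] by simp
  define F where "F y s = indicator {..x} s * (p y * u (s - y))" for y s :: real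
  have Fm [measurable]: "case_prod F \<in> borel_measurable (lborel \<Otimes>\<^sub>M lborel)"
    unfolding F_def by measurable
  have abs_left: "integrable lborel (\<lambda>s. indicator {..0} s * \<bar>u s\<bar>)"
    using integrable_abs[OF u_left] by (simp add: abs_mult)
  note ui = left_integrable[OF u_measurable u_bound u_left]
  have ai: "integrable lborel (\<lambda>s. indicator {..z} s * \<bar>u s\<bar>)" for z
    by (rule left_integrable[OF _ _ abs_left]) (use u_bound in auto)
  \<comment> \<open>The primitive of a bounded function grows at most linearly in \<open>y\<close>,
    so the finite first moment of \<open>p\<close> justifies Fubini.\<close>
  have N_abs: "\<bar>left_integral f (x - y)\<bar> \<le> \<bar>left_integral f x\<bar> + B * \<bar>y\<bar>"
    if "f \<in> borel_measurable borel" "\<And>x. \<bar>f x\<bar> \<le> B" "integrable lborel (\<lambda>s. indicator {..0} s * f s)" for f y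
    using left_integral_diff(2)[OF that, of x y] by linarith
  have Ni: "integrable lborel (\<lambda>y. p y * left_integral f (x - y))"
    if [measurable]: "f \<in> borel_measurable borel" and "\<And>x. \<bar>f x\<bar> \<le> B" "integrable lborel (\<lambda>s. indicator {..0} s * f s)" for f
  proof (rule Bochner_Integration.integrable_bound)
    show "integrable lborel (\<lambda>y. p y * \<bar>left_integral f x\<bar> + B * \<bar>y * p y\<bar>)"
      using p_integrable p_mean by (intro Bochner_Integration.integrable_add integrable_mult_right integrable_mult_left integrable_abs) auto
    show "AE y in lborel. norm (p y * left_integral f (x - y)) \<le> norm (p y * \<bar>left_integral f x\<bar> + B * \<bar>y * p y\<bar>)"
    proof (intro AE_I2)
      fix y
      have "p y * \<bar>left_integral f (x - y)\<bar> \<le> p y * (\<bar>left_integral f x\<bar> + B * \<bar>y\<bar>)"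
        by (intro mult_left_mono N_abs that p_nonneg)
      then show "norm (p y * left_integral f (x - y)) \<le> norm (p y * \<bar>left_integral f x\<bar> + B * \<bar>y * p y\<bar>)"
        using p_nonneg[of y] B by (simp add: abs_mult algebra_simps)
    qed
    show "(\<lambda>y. p y * left_integral f (x - y)) \<in> borel_measurable lborel"
      using that(1) by simp
  qed
  have Fi: "integrable (lborel \<Otimes>\<^sub>M lborel) (case_prod F)"
  proof (rule lborel_pair.Fubini_integrable[OF Fm])
    have "(LINT s|lborel. norm (case_prod F (y, s))) = p y * left_integral (\<lambda>s. \<bar>u s\<bar>) (x - y)" for y
    proof -
      have "(LINT s|lborel. norm (case_prod F (y, s))) = (LINT s|lborel. p y * (indicator {..x} s * \<bar>u (s - y)\<bar>))"
        using p_nonneg[of y] by (intro Bochner_Integration.integral_cong) (auto simp: F_def abs_mult)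
      also have "\<dots> = p y * left_integral (\<lambda>s. \<bar>u s\<bar>) (x - y)"
        using left_integral_shift(1)[of "\<lambda>s. \<bar>u s\<bar>"] by simp
      finally show ?thesis .
    qed
    then show "integrable lborel (\<lambda>y. LINT s|lborel. norm (case_prod F (y, s)))"
      using Ni[OF _ _ abs_left] u_bound by simp
    show "AE y in lborel. integrable lborel (\<lambda>s. case_prod F (y, s))"
    proof (intro AE_I2)
      fix y
      have "integrable lborel (\<lambda>s. p y * (indicator {..x} s * u (s - y)))"
        by (intro integrable_mult_right left_integral_shift(2) ui) measurable
      then show "integrable lborel (\<lambda>s. case_prod F (y, s))" by (simp add: F_def mult.left_commute)
    qed
  qed
  have "(LINT s|lborel. LINT y|lborel. F y s) = (LINT y|lborel. LINT s|lborel. F y s)"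
    by (rule lborel_pair.Fubini_integral[OF Fi])
  moreover have "(LINT s|lborel. F y s) = p y * left_integral u (x - y)" for y
    by (simp add: F_def mult.left_commute[of _ "p y"] left_integral_shift)
  moreover have "(LINT y|lborel. F y s) = indicator {..x} s * u s - indicator {..x} s * g s" for s
    using renewal_eq[of s] by (simp add: F_def right_diff_distrib[symmetric])
  moreover have gi: "integrable lborel (\<lambda>s. indicator {..x} s * g s)"
    by (rule Bochner_Integration.integrable_bound[OF g_integrable]) (auto simp: indicator_def)
  ultimately have "left_integral u x - left_integral g x = (LINT y|lborel. p y * left_integral u (x - y))"
    using ui by (simp add: left_integral_def)
  then show ?thesis
    using Ni[OF u_measurable u_bound u_left] p_integrable p_integral by (simp add: right_diff_distrib)
qed

text \<open>Both sides of \<open>balance\<close> pass to the limit along the translates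
  \<open>ys\<close>. Each increment of the primitive over a distance \<open>y\<close> tends to
  \<open>y * S\<close> and is at most \<open>B * \<bar>y\<bar>\<close>, so the first moment of
  \<open>p\<close> again supplies the majorant.\<close>

lemma limit_value:
  assumes top: "filterlim xs at_top sequentially" and lim: "(\<lambda>n. u (xs n)) \<longlonglongrightarrow> S"
    and up: "\<And>e. 0 < e \<Longrightarrow> \<forall>\<^sub>F x in at_top. u x \<le> S + e"
  shows "S * (LINT y|lborel. y * p y) = (LINT x|lborel. g x)"
proof -
  have B: "0 \<le> B" using u_bound[of 0] by simp
  obtain ys where ys: "filterlim ys at_top sequentially"
    "AE y in lborel. (\<lambda>n. u (ys n - y)) \<longlonglongrightarrow> S"
    using translates_converge[OF assms] by blast
  have diff: "(\<lambda>n. left_integral u (ys n) - left_integral u (ys n - y)) \<longlonglongrightarrow> y * S" for y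
  proof -
    have "(\<lambda>n. LINT t|lborel. (indicator {0..} t - indicator {y..} t) * u (ys n - t))
        \<longlonglongrightarrow> (LINT t|lborel. (indicator {0..} t - indicator {y..} t) * S)"
    proof (rule integral_dominated_convergence[where w = "\<lambda>t. B * indicator {min 0 y..max 0 y} t"])
      show "integrable lborel (\<lambda>t. B * indicator {min 0 y..max 0 y} t)"
        by (intro integrable_mult_right) auto
      show "AE t in lborel. (\<lambda>n. (indicator {0..} t - indicator {y..} t) * u (ys n - t))
          \<longlonglongrightarrow> (indicator {0..} t - indicator {y..} t) * S"
        using ys(2) by eventually_elim (intro tendsto_intros)
      show "AE t in lborel. norm ((indicator {0..} t - indicator {y..} t) * u (ys n - t))
          \<le> B * indicator {min 0 y..max 0 y} t" for n
      proof (intro AE_I2)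
        fix t
        show "norm ((indicator {0..} t - indicator {y..} t) * u (ys n - t)) \<le> B * indicator {min 0 y..max 0 y} t"
          using u_bound[of "ys n - t"] B by (auto simp: indicator_def)
      qed
    qed measurable
    \<comment> \<open>The signed length of the interval from 0 to \<open>y\<close>, which is
      \<open>y\<close> itself for either sign.\<close>
    moreover have "(LINT t|lborel. (indicator {0..} t - indicator {y..} t) :: real) = y"
    proof (cases "0 \<le> y")
      case True
      then have "(LINT t|lborel. (indicator {0..} t - indicator {y..} t) :: real) = (LINT t|lborel. indicator {0..<y} t)"
        by (intro Bochner_Integration.integral_cong) (auto simp: indicator_def)
      then show ?thesis using True by simp
    next
      case False
      then have "(LINT t|lborel. (indicator {0..} t - indicator {y..} t) :: real) = (LINT t|lborel. - indicator {y..<0} t)"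
        by (intro Bochner_Integration.integral_cong) (auto simp: indicator_def)
      then show ?thesis using False by simp
    qed
    ultimately show ?thesis
      by (simp add: left_integral_diff(1)[OF u_measurable u_bound u_left])
  qed
  have "(\<lambda>n. LINT y|lborel. p y * (left_integral u (ys n) - left_integral u (ys n - y)))
      \<longlonglongrightarrow> (LINT y|lborel. p y * (y * S))"
  proof (rule integral_dominated_convergence[where w = "\<lambda>y. B * \<bar>y * p y\<bar>"])
    show "integrable lborel (\<lambda>y. B * \<bar>y * p y\<bar>)"
      using p_mean by (intro integrable_mult_right integrable_abs)
    show "AE y in lborel. (\<lambda>n. p y * (left_integral u (ys n) - left_integral u (ys n - y))) \<longlonglongrightarrow> p y * (y * S)"
      by (intro AE_I2 tendsto_intros diff)
    show "AE y in lborel. norm (p y * (left_integral u (ys n) - left_integral u (ys n - y))) \<le> B * \<bar>y * p y\<bar>" for n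
    proof (intro AE_I2)
      fix y
      have "p y * \<bar>left_integral u (ys n) - left_integral u (ys n - y)\<bar> \<le> p y * (B * \<bar>y\<bar>)"
        by (intro mult_left_mono left_integral_diff(2) u_bound u_left p_nonneg) measurable
      then show "norm (p y * (left_integral u (ys n) - left_integral u (ys n - y))) \<le> B * \<bar>y * p y\<bar>"
        using p_nonneg[of y] by (simp add: abs_mult mult_ac)
    qed
  qed simp_all
  then have "(\<lambda>n. left_integral g (ys n)) \<longlonglongrightarrow> (LINT y|lborel. (y * p y) * S)"
    by (simp add: balance mult_ac)
  moreover have "(\<lambda>n. left_integral g (ys n)) \<longlonglongrightarrow> (LINT x|lborel. g x)"
    unfolding left_integral_def
  proof (rule integral_dominated_convergence[where w = "\<lambda>s. norm (g s)"])
    show "AE s in lborel. (\<lambda>n. indicator {..ys n} s * g s) \<longlonglongrightarrow> g s"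
    proof (intro AE_I2 tendsto_eventually)
      fix s
      have "\<forall>\<^sub>F n in sequentially. s \<le> ys n"
        using ys(1) by (simp add: filterlim_at_top)
      then show "\<forall>\<^sub>F n in sequentially. indicator {..ys n} s * g s = g s"
        by eventually_elim simp
    qed
    show "AE s in lborel. norm (indicator {..ys n} s * g s) \<le> norm (g s)" for n
      by (intro AE_I2) (auto simp: indicator_def)
  qed (use g_integrable in auto)
  ultimately have "(LINT y|lborel. (y * p y) * S) = (LINT x|lborel. g x)"
    using LIMSEQ_unique by blast
  then show ?thesis by (simp add: mult.commute)
qed

text \<open>The upper limits \<open>S\<close> of \<open>u\<close> and \<open>I\<close> of
  \<open>- u\<close> have opposite products with the mean of \<open>p\<close>. A nonzero mean forces
  \<open>I = - S\<close>, so the upper and lower limits of \<open>u\<close> coincide.\<close>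

theorem limit_exists:
  assumes mean: "(LINT y|lborel. y * p y) \<noteq> 0"
  obtains L where "(u \<longlongrightarrow> L) at_top"
proof -
  have u: "(\<lambda>x. - u x) \<in> borel_measurable borel" by measurable
  have ub: "\<bar>- u x\<bar> \<le> B" for x using u_bound[of x] by simp
  have ul: "integrable lborel (\<lambda>s. indicator {..0} s * - u s)" using u_left by simp
  have gi: "integrable lborel (\<lambda>x. - g x)" using g_integrable by simp
  have gv: "((\<lambda>x. - g x) \<longlongrightarrow> 0) at_top" using tendsto_minus[OF g_vanishes] by simp
  have eq: "- u x = (LINT y|lborel. p y * - u (x - y)) + - g x" for x
  proof -
    have "(LINT y|lborel. p y * - u (x - y)) = - (LINT y|lborel. p y * u (x - y))" by simp
    then show ?thesis using renewal_eq[of x] by linarith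
  qed
  have neg: "renewal p (\<lambda>x. - u x) (\<lambda>x. - g x) B R"
    by (rule renewal.intro[OF p_nonneg p_integrable p_integral p_mean R_nonneg p_pos u ub ul gi gv eq])
  obtain xs S where S: "filterlim xs at_top sequentially" "(\<lambda>n. u (xs n)) \<longlonglongrightarrow> S"
    "\<And>e. 0 < e \<Longrightarrow> \<forall>\<^sub>F x in at_top. u x \<le> S + e"
    using limsup_sequence[of u, OF u_bound] by blast
  obtain ys I where I: "filterlim ys at_top sequentially" "(\<lambda>n. - u (ys n)) \<longlonglongrightarrow> I"
    "\<And>e. 0 < e \<Longrightarrow> \<forall>\<^sub>F x in at_top. - u x \<le> I + e"
    using limsup_sequence[of "\<lambda>x. - u x", OF ub] by blast
  have "S * (LINT y|lborel. y * p y) = (LINT x|lborel. g x)" by (rule limit_value[OF S])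
  moreover have "I * (LINT y|lborel. y * p y) = (LINT x|lborel. - g x)" by (rule renewal.limit_value[OF neg I])
  ultimately have "(S + I) * (LINT y|lborel. y * p y) = 0" by (simp add: distrib_right)
  then have IS: "I = - S" using mean by simp
  have "(u \<longlongrightarrow> S) at_top"
  proof (rule tendstoI)
    fix e :: real assume e: "0 < e"
    then have "\<forall>\<^sub>F x in at_top. u x \<le> S + e / 2" "\<forall>\<^sub>F x in at_top. - u x \<le> I + e / 2"
      using S(3)[of "e / 2"] I(3)[of "e / 2"] by simp_all
    then show "\<forall>\<^sub>F x in at_top. dist (u x) S < e"
    proof eventually_elim
      case (elim x)
      then show ?case using e IS unfolding dist_real_def by linarith
    qed
  qed
  then show ?thesis by (rule that)
qed

end

section \<open>Ground states on the line\<close>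

locale log_decay_ground_state = ground_state_density a V lam \<phi>
  for a V :: "real \<Rightarrow> real" and lam :: real and \<phi> :: "real \<Rightarrow> real" +
  fixes c :: real
  assumes c_pos: "0 < c" and decay: "log_decay_rate a c"
begin

lemma kernel_bounds:
  assumes e: "0 < \<epsilon>"
  obtains R where "0 \<le> R" "\<forall>x. R \<le> \<bar>x\<bar> \<longrightarrow> exp (- (c + \<epsilon>) * \<bar>x\<bar>) \<le> a x \<and> a x \<le> exp (- (c - \<epsilon>) * \<bar>x\<bar>)"
proof -
  \<comment> \<open>The cap at \<open>c\<close> makes \<open>c - \<epsilon>'\<close> nonnegative, so
    the strict upper estimate gives \<open>ln (a x) < 0\<close>. As \<open>ln 0 = 0\<close>, this
    excludes \<open>a x = 0\<close>.\<close>
  define \<epsilon>' where "\<epsilon>' = min \<epsilon> c"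
  have e': "0 < \<epsilon>'" "\<epsilon>' \<le> \<epsilon>" "\<epsilon>' \<le> c" using e c_pos by (auto simp: \<epsilon>'_def)
  have "\<forall>\<^sub>F x in at_infinity. dist (ln (a x) / \<bar>x\<bar>) (- c) < \<epsilon>'"
    using decay e'(1) unfolding log_decay_rate_def by (rule tendstoD)
  then obtain b where b: "\<And>x. b \<le> \<bar>x\<bar> \<Longrightarrow> \<bar>ln (a x) / \<bar>x\<bar> + c\<bar> < \<epsilon>'"
    unfolding eventually_at_infinity dist_real_def real_norm_def diff_minus_eq_add by blast
  have "exp (- (c + \<epsilon>) * \<bar>x\<bar>) \<le> a x \<and> a x \<le> exp (- (c - \<epsilon>) * \<bar>x\<bar>)" if x: "max b 1 \<le> \<bar>x\<bar>" for x
  proof -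
    have *: "ln (a x) / \<bar>x\<bar> < - (c - \<epsilon>')" "- (c + \<epsilon>') < ln (a x) / \<bar>x\<bar>"
      using b[of x] x unfolding abs_less_iff by linarith+
    have "0 < \<bar>x\<bar>" using x by linarith
    then have **: "ln (a x) < - (c - \<epsilon>') * \<bar>x\<bar>" "- (c + \<epsilon>') * \<bar>x\<bar> < ln (a x)"
      using * pos_divide_less_eq pos_less_divide_eq by blast+
    have "0 \<le> (c - \<epsilon>') * \<bar>x\<bar>" using e' by simp
    then have "ln (a x) < 0" using **(1) by linarith
    then have "a x \<noteq> 0" by (metis ln_0 less_irrefl)
    then have ax: "0 < a x" using a_nonneg[of x] by simp
    have "- (c + \<epsilon>) * \<bar>x\<bar> \<le> - (c + \<epsilon>') * \<bar>x\<bar>" "- (c - \<epsilon>') * \<bar>x\<bar> \<le> - (c - \<epsilon>) * \<bar>x\<bar>"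
      by (rule mult_right_mono, use e' in linarith, simp)+
    then have "exp (- (c + \<epsilon>) * \<bar>x\<bar>) \<le> exp (ln (a x))" "exp (ln (a x)) \<le> exp (- (c - \<epsilon>) * \<bar>x\<bar>)"
      unfolding exp_le_cancel_iff using ** by linarith+
    then show ?thesis unfolding exp_ln[OF ax] by blast
  qed
  then show ?thesis using that[of "max b 1"] by simp
qed

lemma kernel_exp_bound:
  assumes "\<kappa> < c"
  obtains K where "0 < K" "\<And>x. a x \<le> K * exp (- \<kappa> * \<bar>x\<bar>)"
proof -
  obtain R where R: "\<And>x. R \<le> \<bar>x\<bar> \<Longrightarrow> a x \<le> exp (- (c - (c - \<kappa>)) * \<bar>x\<bar>)"
    using kernel_bounds[of "c - \<kappa>"] assms by (metis diff_gt_0_iff_gt assms)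
  have "bounded (range a)" using kernel by (simp add: dispersal_kernel_def)
  then obtain A where A: "0 < A" "\<And>x. a x \<le> A"
    unfolding bounded_pos by (auto intro: order_trans[OF abs_ge_self])
  \<comment> \<open>The value 1 serves where the decay estimate holds; the other one compensates the
    bound \<open>A\<close> on the remaining bounded set. The absolute values allow negative
    \<open>\<kappa>\<close>.\<close>
  define K where "K = max 1 (A * exp (\<bar>\<kappa>\<bar> * \<bar>R\<bar>))"
  have "a x \<le> K * exp (- \<kappa> * \<bar>x\<bar>)" for x
  proof (cases "R \<le> \<bar>x\<bar>")
    case True
    then have "a x \<le> 1 * exp (- \<kappa> * \<bar>x\<bar>)" using R[of x] by simp
    also have "\<dots> \<le> K * exp (- \<kappa> * \<bar>x\<bar>)" by (intro mult_right_mono) (auto simp: K_def)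
    finally show ?thesis .
  next
    case False
    have "\<kappa> * \<bar>x\<bar> \<le> \<bar>\<kappa>\<bar> * \<bar>R\<bar>"
      using False by (intro mult_mono) auto
    then have "1 \<le> exp (\<bar>\<kappa>\<bar> * \<bar>R\<bar>) * exp (- \<kappa> * \<bar>x\<bar>)" by (simp add: exp_add[symmetric])
    then have "A * 1 \<le> A * (exp (\<bar>\<kappa>\<bar> * \<bar>R\<bar>) * exp (- \<kappa> * \<bar>x\<bar>))"
      using A(1) by (intro mult_left_mono) auto
    also have "\<dots> \<le> K * exp (- \<kappa> * \<bar>x\<bar>)"
      unfolding mult.assoc[symmetric] by (intro mult_right_mono) (auto simp: K_def)
    finally show ?thesis using A(2)[of x] by simp
  qed
  moreover have "0 < K" by (simp add: K_def)
  ultimately show ?thesis using that by blast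
qed

lemma tilted_integrable:
  assumes "\<kappa> < c"
  shows "integrable lborel (\<lambda>x. a x * exp (\<kappa> * norm x))"
proof -
  \<comment> \<open>Half of the gap below \<open>c\<close> is left over as genuine exponential
    decay.\<close>
  define \<eta> where "\<eta> = (c - \<kappa>) / 2"
  have eta: "0 < \<eta>" "\<kappa> + \<eta> < c" using assms by (auto simp: \<eta>_def field_simps)
  obtain K where K: "0 < K" "\<And>x. a x \<le> K * exp (- (\<kappa> + \<eta>) * \<bar>x\<bar>)"
    using kernel_exp_bound[OF eta(2)] by blast
  show ?thesis
  proof (rule Bochner_Integration.integrable_bound)
    show "integrable lborel (\<lambda>x::real. K * exp (- \<eta> * norm x))"
      using integrable_exp_norm[OF eta(1)] by (rule integrable_mult_right)
    show "AE x in lborel. norm (a x * exp (\<kappa> * norm x)) \<le> norm (K * exp (- \<eta> * norm x))"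
    proof (intro AE_I2)
      fix x
      have "a x * exp (\<kappa> * norm x) \<le> K * exp (- (\<kappa> + \<eta>) * \<bar>x\<bar>) * exp (\<kappa> * norm x)"
        using K(2) by (intro mult_right_mono) auto
      also have "\<dots> = K * exp (- \<eta> * norm x)" by (simp add: mult.assoc exp_add[symmetric] algebra_simps)
      finally show "norm (a x * exp (\<kappa> * norm x)) \<le> norm (K * exp (- \<eta> * norm x))"
        using a_nonneg[of x] K by (simp add: abs_mult)
    qed
  qed measurable
qed

lemma one_sided_integrable:
  assumes "0 \<le> \<kappa>" "\<kappa> < c"
  shows "integrable lborel (\<lambda>x. a x * exp (\<kappa> * x))"
proof (rule Bochner_Integration.integrable_bound[OF tilted_integrable[OF assms(2)]])
  show "AE x in lborel. norm (a x * exp (\<kappa> * x)) \<le> norm (a x * exp (\<kappa> * norm x))"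
    using assms(1) by (intro AE_I2) (auto simp: abs_mult intro!: mult_left_mono)
qed measurable

text \<open>The weight \<open>h\<close> is chosen by the sign of \<open>x\<close>: the identity for
  \<open>x \<ge> 0\<close> and negation otherwise. Evenness of \<open>a\<close> makes both tilted
  integrals equal, so only the one-sided integral enters, which is smaller than the one with
  \<open>\<bar>z\<bar>\<close> and allows the sharp rate.\<close>

lemma subcritical_upper_bound:
  assumes k: "0 \<le> \<kappa>" "\<kappa> < c" and A: "(LINT x|lborel. a x * exp (\<kappa> * x)) \<le> 1 + lam"
  obtains K where "0 < K" "\<And>x. \<phi> x \<le> K * exp (- \<kappa> * \<bar>x\<bar>)"
proof -
  have i: "integrable lborel (\<lambda>x. a x * exp (\<kappa> * x))" by (rule one_sided_integrable[OF k])
  have "\<exists>h. h \<in> borel_measurable borel \<and> (\<forall>z. norm x \<le> norm (x - z) + h z) \<and>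
         integrable lborel (\<lambda>z. a z * exp (\<kappa> * h z)) \<and> (LINT z|lborel. a z * exp (\<kappa> * h z)) \<le> 1 + lam" for x :: real
  proof (cases "0 \<le> x")
    case True
    then have "\<forall>z. norm x \<le> norm (x - z) + z" by auto
    then show ?thesis using i A by (intro exI[of _ "\<lambda>z. z"] conjI) auto
  next
    case False
    have "integrable lborel (\<lambda>z. a z * exp (\<kappa> * - z))"
      using integrable_reflect[OF i, of 0] by (simp add: a_even)
    moreover have "(LINT z|lborel. a z * exp (\<kappa> * - z)) = (LINT x|lborel. a x * exp (\<kappa> * x))"
      using integral_reflect[of "\<lambda>x. a x * exp (\<kappa> * x)" 0] by (simp add: a_even)
    moreover have "\<forall>z. norm x \<le> norm (x - z) + - z" using False by auto
    ultimately show ?thesis using A by (intro exI[of _ uminus] conjI) simp_all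
  qed
  from exponential_upper_bound[OF k(1) this] obtain K where "0 < K" "\<And>x. \<phi> x \<le> K * exp (- \<kappa> * norm x)"
    by blast
  then show ?thesis using that[of K] unfolding real_norm_def by blast
qed

text \<open>For \<open>\<bar>x\<bar> > R + 1\<close> the unit ball around \<open>x\<close> stays
  where the kernel bound is valid, and \<open>kernel_lower_bound\<close> loses only a factor
  \<open>exp (- (c + \<epsilon>))\<close>. On the remaining interval \<open>\<phi>\<close> has a
  positive minimum; \<open>C\<close> is the smaller of the two constants.\<close>

theorem exponential_lower_bound:
  assumes e: "0 < \<epsilon>"
  obtains C where "0 < C" "\<And>x. C * exp (- (c + \<epsilon>) * \<bar>x\<bar>) \<le> \<phi> x"
proof -
  obtain R where R: "0 \<le> R" "\<And>x. R \<le> \<bar>x\<bar> \<Longrightarrow> exp (- (c + \<epsilon>) * \<bar>x\<bar>) \<le> a x"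
    using kernel_bounds[OF e] by metis
  obtain k where k: "0 < k" "\<And>x t. 0 \<le> t \<Longrightarrow> \<forall>y. norm y \<le> 1 \<longrightarrow> t \<le> a (x - y) \<Longrightarrow> k * t \<le> \<phi> x"
    using kernel_lower_bound by metis
  obtain m where m: "0 < m" "\<And>x. norm x \<le> R + 1 \<Longrightarrow> m \<le> \<phi> x"
    using positive_on_cball[OF \<phi>_cont \<phi>_pos, of "R + 1"] by metis
  define C where "C = min m (k * exp (- (c + \<epsilon>)))"
  have C: "0 < C" "C \<le> m" "C \<le> k * exp (- (c + \<epsilon>))" using m(1) k(1) by (simp_all add: C_def)
  have "C * exp (- (c + \<epsilon>) * \<bar>x\<bar>) \<le> \<phi> x" for x
  proof (cases "\<bar>x\<bar> \<le> R + 1")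
    case True
    have "C * exp (- (c + \<epsilon>) * \<bar>x\<bar>) \<le> C * 1"
      using C e c_pos by (intro mult_left_mono) (auto simp: mult_nonpos_nonneg)
    moreover have "m \<le> \<phi> x" using m(2)[of x] True by simp
    ultimately show ?thesis using C(2) by linarith
  next
    case False
    have "k * exp (- (c + \<epsilon>) * (\<bar>x\<bar> + 1)) \<le> \<phi> x"
    proof (rule k(2); (intro allI impI)?)
      fix y :: real assume y: "norm y \<le> 1"
      have "R \<le> \<bar>x - y\<bar>" "\<bar>x - y\<bar> \<le> \<bar>x\<bar> + 1" using y False by auto
      have "- (c + \<epsilon>) * (\<bar>x\<bar> + 1) \<le> - (c + \<epsilon>) * \<bar>x - y\<bar>"
        using c_pos e \<open>\<bar>x - y\<bar> \<le> \<bar>x\<bar> + 1\<close> by (intro mult_left_mono_neg) auto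
      then show "exp (- (c + \<epsilon>) * (\<bar>x\<bar> + 1)) \<le> a (x - y)"
        by (intro order_trans[OF _ R(2)[OF \<open>R \<le> \<bar>x - y\<bar>\<close>]] iffD2[OF exp_le_cancel_iff])
    qed simp
    moreover have "C * exp (- (c + \<epsilon>) * \<bar>x\<bar>) \<le> k * exp (- (c + \<epsilon>)) * exp (- (c + \<epsilon>) * \<bar>x\<bar>)"
      using C by (intro mult_right_mono) auto
    moreover have "k * exp (- (c + \<epsilon>)) * exp (- (c + \<epsilon>) * \<bar>x\<bar>) = k * exp (- (c + \<epsilon>) * (\<bar>x\<bar> + 1))"
      by (simp add: mult.assoc exp_add[symmetric] algebra_simps)
    ultimately show ?thesis by linarith
  qed
  then show ?thesis by (rule that[OF C(1)])
qed

text \<open>The tilted integral equals 1 without tilt and is continuous. If it exceeded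
  \<open>1 + lam\<close> before the tilt reaches \<open>c\<close>, the intermediate value theorem
  would produce the excluded \<open>q\<close>.\<close>

theorem no_resonance_bounds:
  assumes none: "\<nexists>q. 0 < q \<and> q < c \<and> (LINT x|lborel. a x * exp (q * x)) = 1 + lam" and e: "0 < \<epsilon>"
  obtains Cm Cp where "0 < Cm" "0 < Cp" "\<And>x. Cm * exp (- (c + \<epsilon>) * \<bar>x\<bar>) \<le> \<phi> x"
    "\<And>x. \<phi> x \<le> Cp * exp (- (c - \<epsilon>) * \<bar>x\<bar>)"
proof -
  obtain Cm where Cm: "0 < Cm" "\<And>x. Cm * exp (- (c + \<epsilon>) * \<bar>x\<bar>) \<le> \<phi> x"
    using exponential_lower_bound[OF e] by blast
  \<comment> \<open>For \<open>\<epsilon> > c\<close> the desired rate is negative, and the rate 0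
    is already stronger.\<close>
  define \<kappa> where "\<kappa> = max 0 (c - \<epsilon>)"
  have k: "0 \<le> \<kappa>" "\<kappa> < c" "c - \<epsilon> \<le> \<kappa>" using e c_pos by (auto simp: \<kappa>_def)
  have cont: "continuous_on {0..\<kappa>} (\<lambda>\<kappa>. LINT x|lborel. a x * exp (\<kappa> * x))"
    by (rule tilted_integral_continuous[OF _ _ _ tilted_integrable[OF k(2)]]) auto
  have "(LINT x|lborel. a x * exp (\<kappa> * x)) \<le> 1 + lam"
  proof (rule ccontr)
    assume neg: "\<not> (LINT x|lborel. a x * exp (\<kappa> * x)) \<le> 1 + lam"
    have "\<exists>q\<ge>0. q \<le> \<kappa> \<and> (LINT x|lborel. a x * exp (q * x)) = 1 + lam"
    proof (rule IVT'[of "\<lambda>\<kappa>. LINT x|lborel. a x * exp (\<kappa> * x)", OF _ _ k(1) cont])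
      show "(LINT x|lborel. a x * exp (0 * x)) \<le> 1 + lam" using lam_pos a_integral by simp
      show "1 + lam \<le> (LINT x|lborel. a x * exp (\<kappa> * x))" using neg by simp
    qed
    then obtain q where q: "0 \<le> q" "q \<le> \<kappa>" "(LINT x|lborel. a x * exp (q * x)) = 1 + lam" by blast
    have "q \<noteq> 0"
    proof
      assume "q = 0"
      then show False using q(3) lam_pos a_integral by simp
    qed
    then have "0 < q" "q < c" using q(1,2) k(2) by linarith+
    then show False using none q(3) by blast
  qed
  from subcritical_upper_bound[OF k(1,2) this]
  obtain K where K: "0 < K" "\<And>x. \<phi> x \<le> K * exp (- \<kappa> * \<bar>x\<bar>)" by blast
  have "\<phi> x \<le> K * exp (- (c - \<epsilon>) * \<bar>x\<bar>)" for x
  proof -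
    have "- \<kappa> * \<bar>x\<bar> \<le> - (c - \<epsilon>) * \<bar>x\<bar>" using k(3) by (intro mult_right_mono) auto
    then have "K * exp (- \<kappa> * \<bar>x\<bar>) \<le> K * exp (- (c - \<epsilon>) * \<bar>x\<bar>)" using K(1) by (intro mult_left_mono) auto
    then show ?thesis using K(2)[of x] by linarith
  qed
  then show ?thesis by (rule that[OF Cm(1) K(1) Cm(2)])
qed

text \<open>The resonance condition says exactly that the tilted kernel \<open>p\<close> has mass 1.
  The potential term, supported in a bounded set, becomes the inhomogeneity
  \<open>g\<close>.\<close>

theorem resonance_limit:
  assumes q: "0 < q" "q < c" and A: "(LINT x|lborel. a x * exp (q * x)) = 1 + lam"
  obtains L where "((\<lambda>x. \<phi> x * exp (q * x)) \<longlongrightarrow> L) at_top"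
proof -
  define p where "p y = a y * exp (q * y) / (1 + lam)" for y
  define u where "u x = \<phi> x * exp (q * x)" for x
  define g where "g x = V x * u x / (1 + lam)" for x
  have ai: "integrable lborel (\<lambda>x. a x * exp (q * x))" using one_sided_integrable[of q] q by simp
  \<comment> \<open>The barrier reaches the critical rate \<open>q\<close> itself. Hence
    \<open>u\<close> is bounded by \<open>K\<close>, and by \<open>K * exp (2 * q * x)\<close> for
    \<open>x \<le> 0\<close>, which gives integrability at minus infinity.\<close>
  obtain K where K: "0 < K" "\<And>x. \<phi> x \<le> K * exp (- q * \<bar>x\<bar>)"
    using subcritical_upper_bound[OF less_imp_le[OF q(1)] q(2) eq_refl[OF A]] by blast
  obtain R where R: "0 \<le> R" "\<And>x. R \<le> \<bar>x\<bar> \<Longrightarrow> exp (- (c + 1) * \<bar>x\<bar>) \<le> a x"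
    using kernel_bounds[OF zero_less_one] by metis
  obtain R' where R': "0 < R'" "\<And>x. R' < \<bar>x\<bar> \<Longrightarrow> V x = 0"
    using V_support unfolding real_norm_def by blast
  have [measurable]: "u \<in> borel_measurable borel" "g \<in> borel_measurable borel"
    unfolding u_def[abs_def] g_def[abs_def] by measurable
  have u_nonneg: "0 \<le> u x" for x using \<phi>_pos[of x] by (simp add: u_def)
  have u_exp: "u x \<le> K * exp (q * (x - \<bar>x\<bar>))" for x
  proof -
    have "u x \<le> K * exp (- q * \<bar>x\<bar>) * exp (q * x)" unfolding u_def using K by (intro mult_right_mono) auto
    then show ?thesis by (simp add: mult.assoc exp_add[symmetric] algebra_simps)
  qed
  have u_bound: "\<bar>u x\<bar> \<le> K" for x
  proof -
    have "q * (x - \<bar>x\<bar>) \<le> 0" using q by (intro mult_nonneg_nonpos) auto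
    then have "K * exp (q * (x - \<bar>x\<bar>)) \<le> K * 1" using K by (intro mult_left_mono) auto
    then show ?thesis using u_exp[of x] u_nonneg[of x] by simp
  qed
  \<comment> \<open>A tilt halfway between \<open>q\<close> and \<open>c\<close> is still integrable
    and absorbs the linear factor in first moments.\<close>
  have tp: "integrable lborel (\<lambda>y. a y * exp ((q + c) / 2 * norm y))"
    using q by (intro tilted_integrable) (simp add: field_simps)
  \<comment> \<open>Used at \<open>\<kappa> = q\<close> for the mean of \<open>p\<close> and at
    \<open>\<kappa> = 0\<close> for the vanishing mean of the even kernel.\<close>
  have mean_i: "integrable lborel (\<lambda>y. y * (a y * exp (\<kappa> * y)))" if k: "0 \<le> \<kappa>" "\<kappa> \<le> q" for \<kappa>
  proof (rule Bochner_Integration.integrable_bound)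
    show "integrable lborel (\<lambda>y. 2 / (c - q) * (a y * exp ((q + c) / 2 * norm y)))"
      using tp by (rule integrable_mult_right)
    show "AE y in lborel. norm (y * (a y * exp (\<kappa> * y))) \<le> norm (2 / (c - q) * (a y * exp ((q + c) / 2 * norm y)))"
    proof (intro AE_I2)
      fix y
      have "(c - q) / 2 * \<bar>y\<bar> \<le> exp ((c - q) / 2 * \<bar>y\<bar>)"
        using exp_ge_add_one_self[of "(c - q) / 2 * \<bar>y\<bar>"] by linarith
      then have 1: "\<bar>y\<bar> \<le> 2 / (c - q) * exp ((c - q) / 2 * \<bar>y\<bar>)" using q by (simp add: field_simps)
      have "\<kappa> * y \<le> \<kappa> * \<bar>y\<bar>" using k by (intro mult_left_mono) auto
      also have "\<dots> \<le> q * \<bar>y\<bar>" using k by (intro mult_right_mono) auto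
      finally have "\<kappa> * y \<le> q * \<bar>y\<bar>" .
      then have "\<bar>y\<bar> * exp (\<kappa> * y) \<le> 2 / (c - q) * exp ((c - q) / 2 * \<bar>y\<bar>) * exp (q * \<bar>y\<bar>)"
        using 1 q by (intro mult_mono) auto
      also have "\<dots> = 2 / (c - q) * exp ((q + c) / 2 * norm y)"
        by (simp add: mult.assoc exp_add[symmetric] field_simps)
      finally have "a y * (\<bar>y\<bar> * exp (\<kappa> * y)) \<le> a y * (2 / (c - q) * exp ((q + c) / 2 * norm y))"
        using a_nonneg by (rule mult_left_mono)
      then show "norm (y * (a y * exp (\<kappa> * y))) \<le> norm (2 / (c - q) * (a y * exp ((q + c) / 2 * norm y)))"
        using a_nonneg[of y] q by (simp add: abs_mult mult_ac)
    qed
  qed measurable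
  have g0: "g x = 0" if "R' < \<bar>x\<bar>" for x using R'(2)[OF that] by (simp add: g_def)
  interpret renewal p u g K R
  proof unfold_locales
    show "0 \<le> p y" for y using a_nonneg[of y] lam_pos by (simp add: p_def)
    show "integrable lborel p" using ai by (simp add: p_def[abs_def])
    show "(LINT y|lborel. p y) = 1" using A lam_pos by (simp add: p_def)
    show "integrable lborel (\<lambda>y. y * p y)"
      using mean_i[of q] q by (simp add: p_def)
    show "0 \<le> R" by (rule R(1))
    show "0 < p y" if "R \<le> \<bar>y\<bar>" for y
      using less_le_trans[OF exp_gt_zero R(2)[OF that]] lam_pos by (simp add: p_def)
    show "u \<in> borel_measurable borel" by measurable
    show "\<bar>u x\<bar> \<le> K" for x by (rule u_bound)
    show "integrable lborel (\<lambda>s. indicator {..0} s * u s)"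
    proof (rule Bochner_Integration.integrable_bound)
      show "integrable lborel (\<lambda>s::real. K * exp (- (2 * q) * norm s))"
        using q by (intro integrable_mult_right integrable_exp_norm) simp
      show "AE s in lborel. norm (indicator {..0} s * u s) \<le> norm (K * exp (- (2 * q) * norm s))"
      proof (intro AE_I2)
        fix s :: real
        show "norm (indicator {..0} s * u s) \<le> norm (K * exp (- (2 * q) * norm s))"
          using u_exp[of s] u_nonneg[of s] K(1) by (cases "s \<le> 0") (auto simp: abs_mult mult_ac)
      qed
    qed measurable
    show "integrable lborel g"
    proof (rule Bochner_Integration.integrable_bound)
      show "integrable lborel (\<lambda>x. K / (1 + lam) * indicator {- R'..R'} x)"
        using R'(1) by (intro integrable_mult_right) simp
      show "AE x in lborel. norm (g x) \<le> norm (K / (1 + lam) * indicator {- R'..R'} x)"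
      proof (intro AE_I2)
        fix x
        have "V x * u x \<le> 1 * K" using V_bounds u_bound[of x] u_nonneg[of x] by (intro mult_mono) auto
        then have "norm (g x) \<le> K / (1 + lam)"
          using V_bounds u_nonneg[of x] lam_pos by (simp add: g_def abs_mult divide_right_mono)
        then show "norm (g x) \<le> norm (K / (1 + lam) * indicator {- R'..R'} x)"
          using g0[of x] K(1) lam_pos by (cases "R' < \<bar>x\<bar>") (auto simp: indicator_def abs_le_iff)
      qed
    qed measurable
    show "(g \<longlongrightarrow> 0) at_top"
    proof (rule tendsto_eventually)
      show "\<forall>\<^sub>F x in at_top. g x = 0"
        using eventually_gt_at_top[of R'] by eventually_elim (use g0 in auto)
    qed
    show "u x = (LINT y|lborel. p y * u (x - y)) + g x" for x
    proof -
      \<comment> \<open>The factors \<open>exp (q * y)\<close> and \<open>exp (q * (x - y))\<close>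
        multiply to \<open>exp (q * x)\<close>, which leaves the integral.\<close>
      have "(LINT y|lborel. p y * u (x - y)) = (LINT y|lborel. a y * \<phi> (x - y) * (exp (q * x) / (1 + lam)))"
        by (intro Bochner_Integration.integral_cong)
          (auto simp: p_def u_def exp_add[symmetric] right_diff_distrib exp_diff)
      also have "\<dots> = (LINT y|lborel. a (x - y) * \<phi> y) * (exp (q * x) / (1 + lam))"
        by (simp add: integral_convolution_commute)
      also have "\<dots> = (1 + lam - V x) * u x / (1 + lam)"
        unfolding eigen[symmetric] by (simp add: u_def)
      finally show ?thesis using lam_pos by (simp add: g_def field_simps)
    qed
  qed
  \<comment> \<open>Nonzero mean of \<open>p\<close>: subtracting the vanishing integral of
    \<open>y * a y\<close> leaves this nonnegative integrand, which is strictly positive for large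
    \<open>y\<close>.\<close>
  have pos: "0 \<le> y * a y * (exp (q * y) - 1)" for y
  proof -
    have "0 \<le> y * (exp (q * y) - 1)" using q by (auto simp: zero_le_mult_iff mult_nonneg_nonpos)
    then have "0 \<le> a y * (y * (exp (q * y) - 1))" by (rule mult_nonneg_nonneg[OF a_nonneg])
    then show ?thesis by (simp add: mult_ac)
  qed
  have m0: "integrable lborel (\<lambda>y. y * a y)" using mean_i[of 0] q by simp
  have m1: "integrable lborel (\<lambda>y. y * a y * exp (q * y))" using mean_i[of q] q by (simp add: mult.assoc)
  have "(LINT y|lborel. y * a y) = 0"
    using integral_reflect[of "\<lambda>y. y * a y" 0] by (simp add: a_even)
  then have "(LINT y|lborel. y * a y * exp (q * y)) = (LINT y|lborel. y * a y * (exp (q * y) - 1))"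
    using m0 m1 by (simp add: right_diff_distrib)
  also have "\<dots> \<noteq> 0"
  proof
    assume "(LINT y|lborel. y * a y * (exp (q * y) - 1)) = 0"
    then have "AE y in lborel. y * a y * (exp (q * y) - 1) = 0"
      using integral_nonneg_eq_0_iff_AE[of lborel "\<lambda>y. y * a y * (exp (q * y) - 1)"] m0 m1 pos
      by (simp add: right_diff_distrib)
    then obtain y where y: "R + 1 \<le> y" "y * a y * (exp (q * y) - 1) = 0"
      using AE_lborel_unbounded by blast
    have "R \<le> \<bar>y\<bar>" using y(1) by linarith
    then have "0 < a y" using less_le_trans[OF exp_gt_zero R(2)] by blast
    then show False using y R(1) q by auto
  qed
  finally have "(LINT y|lborel. y * p y) \<noteq> 0"
    using lam_pos by (simp add: p_def mult.assoc)
  then obtain L where "(u \<longlongrightarrow> L) at_top" by (rule limit_exists)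
  then show ?thesis using that by (simp add: u_def[abs_def])
qed

text \<open>Transfers limits at plus infinity to minus infinity: the even kernel is unchanged by
  \<open>x \<mapsto> - x\<close>, while \<open>V\<close> and \<open>\<phi>\<close> are
  reflected.\<close>

lemma reflected: "log_decay_ground_state a (\<lambda>x. V (- x)) lam (\<lambda>x. \<phi> (- x)) c"
proof unfold_locales
  \<comment> \<open>Negation is written as scaling by -1, with which closure commutes.\<close>
  have um: "uminus ` S = (\<lambda>x. - 1 *\<^sub>R x) ` S" for S :: "real set"
    by (rule image_cong) simp_all
  have "{x. V (- x) \<noteq> 0} = uminus ` {x. V x \<noteq> 0}"
  proof (intro set_eqI iffI)
    fix x assume "x \<in> {x. V (- x) \<noteq> 0}"
    then show "x \<in> uminus ` {x. V x \<noteq> 0}" by (intro image_eqI[of _ _ "- x"]) simp_all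
  next
    fix x assume "x \<in> uminus ` {x. V x \<noteq> 0}"
    then show "x \<in> {x. V (- x) \<noteq> 0}" by (elim imageE) simp
  qed
  moreover have "closure (uminus ` {x. V x \<noteq> 0}) = uminus ` closure {x. V x \<noteq> 0}"
    unfolding um[of "{x. V x \<noteq> 0}"] um[of "closure {x. V x \<noteq> 0}"]
    by (rule closure_scaleR[symmetric])
  moreover have "compact (uminus ` closure {x. V x \<noteq> 0})"
    by (rule compact_negations) (use potential in \<open>unfold admissible_potential_def, blast\<close>)
  ultimately have "compact (closure {x. V (- x) \<noteq> 0})" by simp
  moreover have "continuous_on UNIV (\<lambda>x. V (- x))"
  proof (rule continuous_on_compose2[of UNIV V])
    show "continuous_on UNIV V" using potential unfolding admissible_potential_def by blast
  qed (auto intro: continuous_intros)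
  moreover have "\<exists>x. V (- x) \<noteq> 0"
  proof -
    obtain x where "V x \<noteq> 0" using potential unfolding admissible_potential_def by blast
    then show ?thesis by (intro exI[of _ "- x"]) simp
  qed
  ultimately show "admissible_potential (\<lambda>x. V (- x))"
    unfolding admissible_potential_def using V_bounds by blast
  show "continuous_on UNIV (\<lambda>x. \<phi> (- x))"
    by (rule continuous_on_compose2[OF \<phi>_cont]) (auto intro: continuous_intros)
  show "bounded (range (\<lambda>x. \<phi> (- x)))"
    using \<phi>_bounded by (rule bounded_subset) auto
  show "(1 + lam - V (- x)) * \<phi> (- x) = (LINT y|lborel. a (x - y) * \<phi> (- y))" for x
  proof -
    have swap: "a (- x - (0 - y)) = a (x - y)" for y
      using a_even[of "x - y"] by (simp add: algebra_simps)
    have "(LINT y|lborel. a (- x - y) * \<phi> y) = (LINT y|lborel. a (- x - (0 - y)) * \<phi> (0 - y))"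
      by (rule integral_reflect[symmetric]) measurable
    also have "\<dots> = (LINT y|lborel. a (x - y) * \<phi> (- y))"
      unfolding swap by simp
    finally show ?thesis using eigen[of "- x"] by simp
  qed
qed (fact kernel lam_pos \<phi>_pos c_pos decay)+

end

section \<open>The decay statements for ground states\<close>

theorem theorem3p2:
  shows
  "(\<forall>(a::'a::euclidean_space \<Rightarrow> real) V lam \<psi>.
      dispersal_kernel a \<and> admissible_potential V \<and> ground_state a V lam \<psi> \<longrightarrow>
      (\<exists>\<phi>. continuous_representative \<phi> \<psi> \<and>
        (\<forall>\<alpha> cm cp. 0 < \<alpha> \<and> 0 < cm \<and> cm \<le> cp \<and>
           (\<forall>x. cm * (1 + norm x) powr (- (real DIM('a) + \<alpha>)) \<le> a x \<and>
                a x \<le> cp * (1 + norm x) powr (- (real DIM('a) + \<alpha>))) \<longrightarrow>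
           (\<exists>dm dp. 0 < dm \<and> dm \<le> dp \<and>
             (\<forall>x. dm * (1 + norm x) powr (- (real DIM('a) + \<alpha>)) \<le> \<phi> x \<and>
                  \<phi> x \<le> dp * (1 + norm x) powr (- (real DIM('a) + \<alpha>))))) \<and>
        (\<forall>c \<delta>. 0 < c \<and> 0 < \<delta> \<and> (\<forall>x. a x \<le> c * exp (- \<delta> * norm x)) \<longrightarrow>
           (\<exists>K m. 0 < K \<and> 0 < m \<and> (\<forall>x. \<phi> x \<le> K * exp (- m * norm x))))))
   \<and>
   (\<forall>(a::real \<Rightarrow> real) V lam \<psi>.
      dispersal_kernel a \<and> admissible_potential V \<and> ground_state a V lam \<psi> \<longrightarrow>
      (\<exists>\<phi>. continuous_representative \<phi> \<psi> \<and>
        (\<forall>c. 0 < c \<and> log_decay_rate a c \<and>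
           (\<forall>\<kappa>. 0 \<le> \<kappa> \<and> \<kappa> < c \<longrightarrow> integrable lborel (tilted_fourier a \<kappa>)) \<longrightarrow>
           (\<forall>q. 0 < q \<and> q < c \<and> (LINT x|lborel. a x * exp (q * x)) = 1 + lam \<longrightarrow>
              (\<exists>Cp Cm. ((\<lambda>x. \<phi> x * exp (q * \<bar>x\<bar>)) \<longlongrightarrow> Cp) at_top \<and>
                       ((\<lambda>x. \<phi> x * exp (q * \<bar>x\<bar>)) \<longlongrightarrow> Cm) at_bot)) \<and>
           ((\<nexists>q. 0 < q \<and> q < c \<and> (LINT x|lborel. a x * exp (q * x)) = 1 + lam) \<longrightarrow>
              (\<forall>\<epsilon>>0. \<exists>Cm Cp. 0 < Cm \<and> 0 < Cp \<and>
                 (\<forall>x. Cm * exp (- (c + \<epsilon>) * \<bar>x\<bar>) \<le> \<phi> x \<and>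
                      \<phi> x \<le> Cp * exp (- (c - \<epsilon>) * \<bar>x\<bar>)))))))"
proof (intro conjI allI impI, goal_cases)
  case (1 a V lam \<psi>)
  then obtain \<phi> where \<phi>: "continuous_representative \<phi> \<psi>" and gsd: "ground_state_density a V lam \<phi>"
    using ground_state_density_exists[of a V lam \<psi>] by blast
  interpret ground_state_density a V lam \<phi> by (rule gsd)
  show ?case
  proof (intro exI[of _ \<phi>] conjI \<phi> allI impI, goal_cases)
    case (1 \<alpha> cm cp)
    then obtain dm dp where "0 < dm" "dm \<le> dp"
      "\<And>x. dm * (1 + norm x) powr (- (real DIM('a) + \<alpha>)) \<le> \<phi> x"
      "\<And>x. \<phi> x \<le> dp * (1 + norm x) powr (- (real DIM('a) + \<alpha>))"
      using polynomial_case[of "real DIM('a) + \<alpha>" cm cp] by (metis add_pos_pos of_nat_0_less_iff DIM_positive)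
    then show ?case by blast
  next
    case (2 c \<delta>)
    then obtain K m where "0 < K" "0 < m" "\<And>x. \<phi> x \<le> K * exp (- m * norm x)"
      using exponential_case[of c \<delta>] by blast
    then show ?case by blast
  qed
next
  case (2 a V lam \<psi>)
  then obtain \<phi> where \<phi>: "continuous_representative \<phi> \<psi>" and gsd: "ground_state_density a V lam \<phi>"
    using ground_state_density_exists[of a V lam \<psi>] by blast
  show ?case
  proof (intro exI[of _ \<phi>] conjI \<phi> allI impI, goal_cases)
    case (1 c q)
    interpret log_decay_ground_state a V lam \<phi> c
      using gsd 1 by (auto simp: log_decay_ground_state_def log_decay_ground_state_axioms_def)
    obtain Cp where Cp: "((\<lambda>x. \<phi> x * exp (q * x)) \<longlongrightarrow> Cp) at_top"
      using resonance_limit[of q] 1 by blast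
    \<comment> \<open>The constant at minus infinity is the limit at plus infinity for the reflected
      ground state; mirroring the filter below brings it back.\<close>
    obtain Cm where Cm: "((\<lambda>x. \<phi> (- x) * exp (q * x)) \<longlongrightarrow> Cm) at_top"
      using log_decay_ground_state.resonance_limit[OF reflected, of q] 1 by blast
    have "((\<lambda>x. \<phi> x * exp (q * \<bar>x\<bar>)) \<longlongrightarrow> Cp) at_top"
      using Cp by (rule Lim_transform_eventually) (use eventually_ge_at_top[of "0 :: real"] in \<open>eventually_elim, simp\<close>)
    moreover have "((\<lambda>x. \<phi> (- x) * exp (q * \<bar>- x\<bar>)) \<longlongrightarrow> Cm) at_top"
      using Cm by (rule Lim_transform_eventually) (use eventually_ge_at_top[of "0 :: real"] in \<open>eventually_elim, simp\<close>)
    then have "((\<lambda>x. \<phi> x * exp (q * \<bar>x\<bar>)) \<longlongrightarrow> Cm) at_bot"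
      unfolding filterlim_at_bot_mirror .
    ultimately show ?case by blast
  next
    case (2 c \<epsilon>)
    interpret log_decay_ground_state a V lam \<phi> c
      using gsd 2 by (auto simp: log_decay_ground_state_def log_decay_ground_state_axioms_def)
    obtain Cm Cp where "0 < Cm" "0 < Cp" "\<And>x. Cm * exp (- (c + \<epsilon>) * \<bar>x\<bar>) \<le> \<phi> x"
      "\<And>x. \<phi> x \<le> Cp * exp (- (c - \<epsilon>) * \<bar>x\<bar>)"
      using no_resonance_bounds[of \<epsilon>] 2 by blast
    then show ?case by blast
  qed
qed

end
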